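(* Let $V$ be a finite-dimensional irreducible $\mathcal{A}$-module and let $\xi,\xi^{*}\in\mathbb{K}$ be nonzero. Then $\xi x,\xi^{*}y$ act on $V$ as a Leonard pair of Bannai/Ito type. If $V$ is of type $B$ then the Leonard pair is totally bipartite. If $V$ is of type $AB$ then the Leonard pair is totally almost bipartite.
   Context: $\mathbb{K}$ is an algebraically closed field of characteristic zero. $\mathcal{A}$ is the unital associative $\mathbb{K}$-algebra with generators $x,y,z$ and relations $xy+yx=2z$, $yz+zy=2x$, $zx+xz=2y$. Type $B(d)$ ($d\ge 0$ even): an $\mathcal{A}$-module is of type $B(d)$ if it is isomorphic to the irreducible module with basis $\{v_i\}_{i=0}^d$ and, for $0\le i\le d$: $x.v_i=(-1)^i(d-2i)v_i$, $y.v_i=(d-i+1)v_{i-1}+(i+1)v_{i+1}$, $z.v_i=(-1)^{i-1}(d-i+1)v_{i-1}+(-1)^i(i+1)v_{i+1}$, with $v_{-1}=0=v_{d+1}$. Type $AB(d,n)$ ($d\ge 0$ an integer, $n\in\{0,x,y,z\}$): for $a\in\{x,y,z\}$ put $\widehat a(n)=1$ if $n\in\{0,a\}$ and $\widehat a(n)=-1$ otherwise. An $\mathcal{A}$-module is of type $AB(d,n)$ if it is isomorphic to the irreducible module with basis $\{v_i\}_{i=0}^d$ and, for $0\le i\le d$: $x.v_i=\widehat x(n)(-1)^{d+i}(2d-2i+1)v_i$, $y.v_i=\widehat y(n)(-1)^d\big((2d-i+2)v_{i-1}+(i+1)v_{i+1}\big)$, $z.v_i=\widehat z(n)\big((-1)^{i-1}(2d-i+2)v_{i-1}+(-1)^i(i+1)v_{i+1}\big)$,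 with $v_{-1}=0$, $v_{d+1}=v_d$. A module is of type $B$ if it is of type $B(d)$ for some even $d\ge0$, and of type $AB$ if it is of type $AB(d,n)$ for some $d\ge 0$, $n\in\{0,x,y,z\}$. (Every finite-dimensional irreducible $\mathcal{A}$-module is of exactly one of these types.) A tridiagonal matrix is irreducible if every subdiagonal and superdiagonal entry is nonzero. A tridiagonal matrix $B$ indexed by $0,\dots,d$ is bipartite if $B_{ii}=0$ for all $i$; it is almost bipartite if exactly one of $B_{00},B_{dd}$ is nonzero and $B_{ii}=0$ for $1\le i\le d-1$ (for $d=0$ this means $B_{00}\neq0$). A Leonard pair on a $\mathbb{K}$-vector space $V$ of dimension $d+1\geq 1$ is an ordered pair of linear maps $A,A^*:V\to V$ such that (1) there is a basis $\{v_i\}_{i=0}^d$ in which $A$ is diagonal and $A^*$ is irreducible tridiagonal, and (2) there is a basis $\{v_i^*\}_{i=0}^d$ in which $A^*$ is diagonal and $A$ is irreducible tridiagonal. It is totally bipartite (resp. totally almost bipartite) if the matrix of $A^*$ in (1) and the matrix of $A$ in (2) are both bipartite (resp. almost bipartite). With $\theta_i,\theta_i^*$ the eigenvalues of $A,A^*$ for $v_i,v_i^*$ respectively, the Leonard pair is of Bannai/Ito type if $\frac{\theta_{i-2}-\theta_{i+1}}{\theta_{i-1}-\theta_i}=\frac{\theta^*_{i-2}-\theta^*_{i+1}}{\theta^*_{i-1}-\theta^*_i}=-1$ for $2\le i\le d-1$ (a vacuous condition when $d\le 2$). *)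

theory Defs
  imports
    "HOL-Computational_Algebra.Polynomial"
    "HOL-Library.Poly_Mapping"
begin

section \<open>The algebra\<close>

datatype gen = X | Y | Z

text \<open>Words in the generators under concatenation, written additively because the monoid
  algebra construction of \<open>Poly_Mapping\<close> expects a (not necessarily commutative) additive monoid
  of exponents.\<close>

datatype gword = Word "gen list"

instantiation gword :: monoid_add
begin

definition zero_gword :: gword where
  "0 = Word []"

fun plus_gword :: "gword \<Rightarrow> gword \<Rightarrow> gword" where
  "Word u + Word v = Word (u @ v)"

instance
proof
  fix a b c :: gword
  show "a + b + c = a + (b + c)"
    by (cases a; cases b; cases c) simp
  show "0 + a = a" "a + 0 = a"
    by (cases a; simp add: zero_gword_def)+
qed

end

type_synonym 'k free_alg = "gword \<Rightarrow>\<^sub>0 'k"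

definition free_gen :: "gen \<Rightarrow> 'k::field free_alg" where
  "free_gen g = Poly_Mapping.single (Word [g]) 1"

definition free_scale :: "'k::field \<Rightarrow> 'k free_alg \<Rightarrow> 'k free_alg" where
  "free_scale c p = Poly_Mapping.single 0 c * p"

definition relators :: "'k::field free_alg set" where
  "relators =
    {free_gen X * free_gen Y + free_gen Y * free_gen X - 2 * free_gen Z,
     free_gen Y * free_gen Z + free_gen Z * free_gen Y - 2 * free_gen X,
     free_gen Z * free_gen X + free_gen X * free_gen Z - 2 * free_gen Y}"

text \<open>The two-sided ideal generated by the relators.\<close>

inductive_set rel_ideal :: "'k::field free_alg set" where
  zero: "0 \<in> rel_ideal"
| mult: "r \<in> relators \<Longrightarrow> a * r * b \<in> rel_ideal"
| add: "p \<in> rel_ideal \<Longrightarrow> q \<in> rel_ideal \<Longrightarrow> p + q \<in> rel_ideal"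

lemma rel_ideal_mult_left: "p \<in> rel_ideal \<Longrightarrow> a * p \<in> rel_ideal"
proof (induction rule: rel_ideal.induct)
  case (mult r b c)
  show ?case using rel_ideal.mult[OF mult, of "a * b" c] by (simp add: mult.assoc)
qed (auto simp: distrib_left intro: rel_ideal.intros)

lemma rel_ideal_mult_right: "p \<in> rel_ideal \<Longrightarrow> p * a \<in> rel_ideal"
proof (induction rule: rel_ideal.induct)
  case (mult r b c)
  show ?case using rel_ideal.mult[OF mult, of b "c * a"] by (simp add: mult.assoc)
qed (auto simp: distrib_right intro: rel_ideal.intros)

lemma rel_ideal_uminus: "p \<in> rel_ideal \<Longrightarrow> - p \<in> rel_ideal"
  using rel_ideal_mult_left[of p "- 1"] by simp

lemma const_coeff_mult:
  fixes p q :: "'k::field free_alg"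
  shows "Poly_Mapping.lookup (p * q) 0 = Poly_Mapping.lookup p 0 * Poly_Mapping.lookup q 0"
proof -
  have split: "(0 = l + m) \<longleftrightarrow> l = 0 \<and> m = 0" for l m :: gword
    by (cases l; cases m) (auto simp: zero_gword_def)
  have inner: "Sum_any (\<lambda>m. Poly_Mapping.lookup q m when (0::gword) = l + m) =
    (Poly_Mapping.lookup q 0 when l = 0)" for l
    by (cases "l = 0") (simp_all add: split)
  have "Poly_Mapping.lookup (p * q) 0 =
      Sum_any (\<lambda>l. Poly_Mapping.lookup p l * (Poly_Mapping.lookup q 0 when l = 0))"
    by (simp only: lookup_mult inner)
  also have "\<dots> =
      Sum_any (\<lambda>l. (Poly_Mapping.lookup p l * Poly_Mapping.lookup q 0) when l = 0)"
    by (simp only: mult_when)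
  finally show ?thesis by simp
qed

lemma rel_ideal_const_coeff:
  fixes p :: "'k::field free_alg"
  assumes "p \<in> rel_ideal"
  shows "Poly_Mapping.lookup p 0 = 0"
proof -
  have gen: "Poly_Mapping.lookup (free_gen g :: 'k free_alg) 0 = 0" for g
    by (simp add: free_gen_def lookup_single zero_gword_def)
  have rel: "r \<in> relators \<Longrightarrow> Poly_Mapping.lookup r 0 = 0" for r :: "'k free_alg"
    by (auto simp: relators_def lookup_add lookup_minus const_coeff_mult gen)
  from assms show ?thesis
    by (induction rule: rel_ideal.induct) (simp_all add: const_coeff_mult rel lookup_add)
qed

quotient_type (overloaded) 'k bi_alg = "'k::field free_alg" / "\<lambda>p q. p - q \<in> rel_ideal"
proof (rule equivpI)
  show "reflp (\<lambda>p q :: 'k free_alg. p - q \<in> rel_ideal)"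
    by (rule reflpI) (simp add: rel_ideal.zero)
  show "symp (\<lambda>p q :: 'k free_alg. p - q \<in> rel_ideal)"
  proof (rule sympI)
    fix p q :: "'k free_alg"
    assume "p - q \<in> rel_ideal"
    from rel_ideal_uminus[OF this] show "q - p \<in> rel_ideal" by simp
  qed
  show "transp (\<lambda>p q :: 'k free_alg. p - q \<in> rel_ideal)"
  proof (rule transpI)
    fix p q r :: "'k free_alg"
    assume "p - q \<in> rel_ideal" "q - r \<in> rel_ideal"
    from rel_ideal.add[OF this] show "p - r \<in> rel_ideal" by simp
  qed
qed

instantiation bi_alg :: (field) ring_1
begin

lift_definition zero_bi_alg :: "'a bi_alg" is 0 .
lift_definition one_bi_alg :: "'a bi_alg" is 1 .

lift_definition plus_bi_alg :: "'a bi_alg \<Rightarrow> 'a bi_alg \<Rightarrow> 'a bi_alg" is "(+)"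
proof -
  fix p p' q q' :: "'a free_alg"
  assume "p - p' \<in> rel_ideal" "q - q' \<in> rel_ideal"
  from rel_ideal.add[OF this] show "p + q - (p' + q') \<in> rel_ideal"
    by (simp add: algebra_simps)
qed

lift_definition uminus_bi_alg :: "'a bi_alg \<Rightarrow> 'a bi_alg" is uminus
proof -
  fix p q :: "'a free_alg"
  assume "p - q \<in> rel_ideal"
  from rel_ideal_uminus[OF this] show "- p - - q \<in> rel_ideal" by simp
qed

lift_definition minus_bi_alg :: "'a bi_alg \<Rightarrow> 'a bi_alg \<Rightarrow> 'a bi_alg" is "(-)"
proof -
  fix p p' q q' :: "'a free_alg"
  assume "p - p' \<in> rel_ideal" "q - q' \<in> rel_ideal"
  from rel_ideal.add[OF this(1) rel_ideal_uminus[OF this(2)]]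
  show "p - q - (p' - q') \<in> rel_ideal"
    by (simp add: algebra_simps)
qed

lift_definition times_bi_alg :: "'a bi_alg \<Rightarrow> 'a bi_alg \<Rightarrow> 'a bi_alg" is "(*)"
proof -
  fix p p' q q' :: "'a free_alg"
  assume "p - p' \<in> rel_ideal" "q - q' \<in> rel_ideal"
  from rel_ideal.add[OF rel_ideal_mult_right[OF this(1), of q] rel_ideal_mult_left[OF this(2), of p']]
  show "p * q - p' * q' \<in> rel_ideal"
    by (simp add: algebra_simps)
qed

instance
proof
  have one: "(1::'a free_alg) - 0 \<notin> rel_ideal"
  proof
    assume "(1::'a free_alg) - 0 \<in> rel_ideal"
    from rel_ideal_const_coeff[OF this] show False by simp
  qed
  show "(0::'a bi_alg) \<noteq> 1"
  proof transfer
    show "(0::'a free_alg) - 1 \<notin> rel_ideal"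
      using one rel_ideal_uminus[of "(0::'a free_alg) - 1"] by auto
  qed
qed (transfer; simp add: distrib_left distrib_right mult.assoc rel_ideal.zero)+

end

lift_definition alg_gen :: "gen \<Rightarrow> 'k::field bi_alg" is free_gen .

lift_definition alg_scale :: "'k::field \<Rightarrow> 'k bi_alg \<Rightarrow> 'k bi_alg" is free_scale
  unfolding free_scale_def right_diff_distrib[symmetric] by (rule rel_ideal_mult_left)

lemma bi_alg_relations:
  "alg_gen X * alg_gen Y + alg_gen Y * alg_gen X = 2 * (alg_gen Z :: 'k::field bi_alg)"
  "alg_gen Y * alg_gen Z + alg_gen Z * alg_gen Y = 2 * (alg_gen X :: 'k bi_alg)"
  "alg_gen Z * alg_gen X + alg_gen X * alg_gen Z = 2 * (alg_gen Y :: 'k bi_alg)"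
proof -
  have in_ideal: "r \<in> rel_ideal" if "r \<in> relators" for r :: "'k free_alg"
    using rel_ideal.mult[OF that, of 1 1] by simp
  have two: "(2::'k free_alg) = 1 + 1" "(2::'k bi_alg) = 1 + 1" by simp_all
  show "alg_gen X * alg_gen Y + alg_gen Y * alg_gen X = 2 * (alg_gen Z :: 'k bi_alg)"
    unfolding two by transfer (rule in_ideal, simp add: relators_def)
  show "alg_gen Y * alg_gen Z + alg_gen Z * alg_gen Y = 2 * (alg_gen X :: 'k bi_alg)"
    unfolding two by transfer (rule in_ideal, simp add: relators_def)
  show "alg_gen Z * alg_gen X + alg_gen X * alg_gen Z = 2 * (alg_gen Y :: 'k bi_alg)"
    unfolding two by transfer (rule in_ideal, simp add: relators_def)
qed


section \<open>Leonard pairs\<close>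

text \<open>Matrices with rows and columns \<open>0, \<dots>, d\<close> are functions on pairs of naturals; entries
  outside this range are irrelevant.\<close>

definition diagonal_mat :: "nat \<Rightarrow> (nat \<Rightarrow> nat \<Rightarrow> 'k::zero) \<Rightarrow> bool" where
  "diagonal_mat d B \<longleftrightarrow> (\<forall>i\<le>d. \<forall>j\<le>d. i \<noteq> j \<longrightarrow> B i j = 0)"

definition tridiagonal_mat :: "nat \<Rightarrow> (nat \<Rightarrow> nat \<Rightarrow> 'k::zero) \<Rightarrow> bool" where
  "tridiagonal_mat d B \<longleftrightarrow> (\<forall>i\<le>d. \<forall>j\<le>d. Suc i < j \<or> Suc j < i \<longrightarrow> B i j = 0)"

definition irreducible_tridiagonal_mat :: "nat \<Rightarrow> (nat \<Rightarrow> nat \<Rightarrow> 'k::zero) \<Rightarrow> bool" where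
  "irreducible_tridiagonal_mat d B \<longleftrightarrow>
     tridiagonal_mat d B \<and> (\<forall>i<d. B i (Suc i) \<noteq> 0 \<and> B (Suc i) i \<noteq> 0)"

definition bipartite_mat :: "nat \<Rightarrow> (nat \<Rightarrow> nat \<Rightarrow> 'k::zero) \<Rightarrow> bool" where
  "bipartite_mat d B \<longleftrightarrow> (\<forall>i\<le>d. B i i = 0)"

definition almost_bipartite_mat :: "nat \<Rightarrow> (nat \<Rightarrow> nat \<Rightarrow> 'k::zero) \<Rightarrow> bool" where
  "almost_bipartite_mat d B \<longleftrightarrow>
     (if d = 0 then B 0 0 \<noteq> 0
      else (B 0 0 \<noteq> 0) \<noteq> (B d d \<noteq> 0) \<and> (\<forall>i. 1 \<le> i \<and> i \<le> d - 1 \<longrightarrow> B i i = 0))"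

definition (in vector_space) fin_dim :: bool where
  "fin_dim \<longleftrightarrow> (\<exists>S. finite S \<and> span S = UNIV)"

text \<open>\<open>v 0, \<dots>, v d\<close> is a basis of the whole space, so the dimension is \<open>d + 1\<close>.\<close>

definition (in vector_space) indexed_basis :: "nat \<Rightarrow> (nat \<Rightarrow> 'b) \<Rightarrow> bool" where
  "indexed_basis d v \<longleftrightarrow>
     inj_on v {..d} \<and> independent (v ` {..d}) \<and> span (v ` {..d}) = UNIV"

text \<open>Column convention: \<open>T (v j)\<close> is the sum over \<open>i\<close> of \<open>mat_of d v T i j *s v i\<close>.\<close>

definition (in vector_space) mat_of :: "nat \<Rightarrow> (nat \<Rightarrow> 'b) \<Rightarrow> ('b \<Rightarrow> 'b) \<Rightarrow> nat \<Rightarrow> nat \<Rightarrow> 'a" where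
  "mat_of d v T i j = representation (v ` {..d}) (T (v j)) (v i)"

definition (in vector_space) diag_tridiag_basis :: "('b \<Rightarrow> 'b) \<Rightarrow> ('b \<Rightarrow> 'b) \<Rightarrow> nat \<Rightarrow> (nat \<Rightarrow> 'b) \<Rightarrow> bool" where
  "diag_tridiag_basis A B d v \<longleftrightarrow>
     indexed_basis d v \<and> diagonal_mat d (mat_of d v A) \<and>
     irreducible_tridiagonal_mat d (mat_of d v B)"

definition (in vector_space) leonard_pair :: "('b \<Rightarrow> 'b) \<Rightarrow> ('b \<Rightarrow> 'b) \<Rightarrow> bool" where
  "leonard_pair A A' \<longleftrightarrow>
     Vector_Spaces.linear scale scale A \<and> Vector_Spaces.linear scale scale A' \<and>
     (\<exists>d. (\<exists>v. diag_tridiag_basis A A' d v) \<and> (\<exists>v'. diag_tridiag_basis A' A d v'))"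

text \<open>The bases in the definition of a Leonard pair are not unique (they can be rescaled and
  reversed). The three properties below are required for every choice of them; such bases exist
  because a Leonard pair is demanded.\<close>

definition (in vector_space) totally_bipartite :: "('b \<Rightarrow> 'b) \<Rightarrow> ('b \<Rightarrow> 'b) \<Rightarrow> bool" where
  "totally_bipartite A A' \<longleftrightarrow> leonard_pair A A' \<and>
     (\<forall>d v v'. diag_tridiag_basis A A' d v \<and> diag_tridiag_basis A' A d v' \<longrightarrow>
        bipartite_mat d (mat_of d v A') \<and> bipartite_mat d (mat_of d v' A))"

definition (in vector_space) totally_almost_bipartite :: "('b \<Rightarrow> 'b) \<Rightarrow> ('b \<Rightarrow> 'b) \<Rightarrow> bool" where
  "totally_almost_bipartite A A' \<longleftrightarrow> leonard_pair A A' \<and>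
     (\<forall>d v v'. diag_tridiag_basis A A' d v \<and> diag_tridiag_basis A' A d v' \<longrightarrow>
        almost_bipartite_mat d (mat_of d v A') \<and> almost_bipartite_mat d (mat_of d v' A))"

text \<open>The eigenvalue of \<open>A\<close> for \<open>v i\<close> is the \<open>i\<close>-th diagonal entry of its diagonal matrix.\<close>

definition (in vector_space) bannai_ito_type :: "('b \<Rightarrow> 'b) \<Rightarrow> ('b \<Rightarrow> 'b) \<Rightarrow> bool" where
  "bannai_ito_type A A' \<longleftrightarrow> leonard_pair A A' \<and>
     (\<forall>d v v'. diag_tridiag_basis A A' d v \<and> diag_tridiag_basis A' A d v' \<longrightarrow>
        (let \<theta> = (\<lambda>i. mat_of d v A i i); \<theta>' = (\<lambda>i. mat_of d v' A' i i) in
         \<forall>i. 2 \<le> i \<and> i + 1 \<le> d \<longrightarrow>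
           (\<theta> (i - 2) - \<theta> (i + 1)) / (\<theta> (i - 1) - \<theta> i) = - 1 \<and>
           (\<theta>' (i - 2) - \<theta>' (i + 1)) / (\<theta>' (i - 1) - \<theta>' i) = - 1))"


section \<open>Modules\<close>

locale bi_module = vector_space scale
  for scale :: "'k::field \<Rightarrow> 'v::ab_group_add \<Rightarrow> 'v" (infixr \<open>*s\<close> 75) +
  fixes act :: "'k bi_alg \<Rightarrow> 'v \<Rightarrow> 'v"
  assumes act_add_right: "act a (u + v) = act a u + act a v"
    and act_add_left: "act (a + b) v = act a v + act b v"
    and act_mult: "act (a * b) v = act a (act b v)"
    and act_one: "act 1 v = v"
    and act_scale_left: "act (alg_scale c a) v = c *s act a v"
    and act_scale_right: "act a (c *s v) = c *s act a v"
begin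

definition submodule :: "'v set \<Rightarrow> bool" where
  "submodule W \<longleftrightarrow> subspace W \<and> (\<forall>a. \<forall>w\<in>W. act a w \<in> W)"

definition irreducible_module :: bool where
  "irreducible_module \<longleftrightarrow>
     (UNIV :: 'v set) \<noteq> {0} \<and> (\<forall>W. submodule W \<longrightarrow> W = {0} \<or> W = UNIV)"

text \<open>A module is isomorphic to the module with the stated basis and action if and only if it
  has itself a basis with that action. The auxiliary \<open>lo i\<close> and \<open>hi i\<close> stand for \<open>v\<^bsub>i-1\<^esub>\<close> and
  \<open>v\<^bsub>i+1\<^esub>\<close>, with the boundary conventions built in, and \<open>(-1)\<^bsup>i+1\<^esup>\<close> is written for
  \<open>(-1)\<^bsup>i-1\<^esup>\<close>.\<close>

definition type_B_of :: "nat \<Rightarrow> bool" where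
  "type_B_of d \<longleftrightarrow> even d \<and>
     (\<exists>v. indexed_basis d v \<and>
       (let lo = (\<lambda>i. if i = 0 then 0 else v (i - 1));
            hi = (\<lambda>i. if i = d then 0 else v (i + 1));
            \<delta> = of_nat d :: 'k in
        \<forall>i\<le>d. let \<iota> = of_nat i :: 'k in
          act (alg_gen X) (v i) = ((- 1) ^ i * (\<delta> - 2 * \<iota>)) *s v i \<and>
          act (alg_gen Y) (v i) = (\<delta> - \<iota> + 1) *s lo i + (\<iota> + 1) *s hi i \<and>
          act (alg_gen Z) (v i) =
            ((- 1) ^ (i + 1) * (\<delta> - \<iota> + 1)) *s lo i + ((- 1) ^ i * (\<iota> + 1)) *s hi i))"

text \<open>\<open>n = None\<close> encodes the label \<open>0\<close> and \<open>n = Some g\<close> the label \<open>g\<close>.\<close>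

definition hat :: "gen \<Rightarrow> gen option \<Rightarrow> 'k" where
  "hat a n = (if n = None \<or> n = Some a then 1 else - 1)"

definition type_AB_of :: "nat \<Rightarrow> gen option \<Rightarrow> bool" where
  "type_AB_of d n \<longleftrightarrow>
     (\<exists>v. indexed_basis d v \<and>
       (let lo = (\<lambda>i. if i = 0 then 0 else v (i - 1));
            hi = (\<lambda>i. if i = d then v d else v (i + 1));
            \<delta> = of_nat d :: 'k in
        \<forall>i\<le>d. let \<iota> = of_nat i :: 'k in
          act (alg_gen X) (v i) = (hat X n * (- 1) ^ (d + i) * (2 * \<delta> - 2 * \<iota> + 1)) *s v i \<and>
          act (alg_gen Y) (v i) =
            (hat Y n * (- 1) ^ d) *s ((2 * \<delta> - \<iota> + 2) *s lo i + (\<iota> + 1) *s hi i) \<and>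
          act (alg_gen Z) (v i) =
            hat Z n *s (((- 1) ^ (i + 1) * (2 * \<delta> - \<iota> + 2)) *s lo i
                        + ((- 1) ^ i * (\<iota> + 1)) *s hi i)))"

definition type_B :: bool where
  "type_B \<longleftrightarrow> (\<exists>d. type_B_of d)"

definition type_AB :: bool where
  "type_AB \<longleftrightarrow> (\<exists>d n. type_AB_of d n)"

end

end

theory Submission
  imports Defs
begin

text \<open>
  Write \<open>R = y + z\<close> and \<open>L = y - z\<close>. The relations give \<open>xR + Rx = 2R\<close>, \<open>xL + Lx = - 2L\<close> and
  \<open>R\<^sup>2 - L\<^sup>2 = 4x\<close>, so \<open>R\<close> and \<open>L\<close> map the \<open>\<theta>\<close>-eigenspace of \<open>x\<close> to the eigenspaces of
  \<open>2 - \<theta>\<close> and \<open>- 2 - \<theta>\<close>. The only fixed points of these reflections are \<open>1\<close> and \<open>- 1\<close>. If \<open>x\<close>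
  has an eigenvalue \<open>1\<close>, start from a common eigenvector of \<open>x\<close> and \<open>R\<close>; if \<open>x\<close> has no eigenvalue
  \<open>1\<close> or \<open>- 1\<close>, start from an \<open>x\<close>-eigenvector killed by \<open>R\<close>; the remaining cases follow from the
  automorphism \<open>(x, y, z) \<mapsto> (- x, y, - z)\<close>. The alternating chain \<open>w, Lw, RLw, \<dots>\<close> then consists
  of eigenvectors for distinct eigenvalues until it vanishes, it spans the module, and
  \<open>y = (R + L) / 2\<close> is irreducible tridiagonal on it. Exchanging \<open>x\<close> and \<open>y\<close> gives the second basis.

  For arbitrary bases as in the definition of a Leonard pair, \<open>x\<^sup>2y + 2xyx + yx\<^sup>2 = 4y\<close> yields
  \<open>((\<theta>\<^sub>i + \<theta>\<^sub>j)\<^sup>2 - 4) y\<^sub>i\<^sub>j = 0\<close>. Hence \<open>\<theta>\<^sub>i + \<theta>\<^sub>i\<^sub>+\<^sub>1\<close> alternates between \<open>2\<close> and \<open>- 2\<close>, which is the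
  Bannai/Ito condition, and a diagonal entry of \<open>y\<close> can be nonzero only where \<open>\<theta>\<^sub>i = 1\<close> or
  \<open>\<theta>\<^sub>i = - 1\<close>. On a module of dimension \<open>n\<close> the Casimir element \<open>x\<^sup>2 + y\<^sup>2 + z\<^sup>2\<close> acts as
  \<open>4n\<^sup>2 - 1\<close> if \<open>x\<close> has an eigenvalue \<open>1\<close> or \<open>- 1\<close>, and as \<open>n\<^sup>2 - 1\<close> otherwise. As it is symmetric
  in the generators, the two alternatives hold simultaneously for \<open>x\<close> and \<open>y\<close>.
\<close>

section \<open>Eigenbases\<close>

context vector_space
begin

definition coord :: "nat \<Rightarrow> (nat \<Rightarrow> 'b) \<Rightarrow> nat \<Rightarrow> 'b \<Rightarrow> 'a" where
  "coord d v i u = representation (v ` {..d}) u (v i)"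

end

context vector_space
begin

lemma mat_of_coord: "mat_of d v T i j = coord d v i (T (v j))"
  by (simp add: mat_of_def coord_def)

lemma
  assumes "indexed_basis d v"
  shows coord_add: "coord d v i (u + u') = coord d v i u + coord d v i u'"
    and coord_scale: "coord d v i (c *s u) = c * coord d v i u"
    and coord_zero: "coord d v i 0 = 0"
  using assms
  by (simp_all add: indexed_basis_def coord_def representation_add representation_scale
      representation_zero)

lemma coord_basis:
  assumes "indexed_basis d v" "i \<le> d" "j \<le> d"
  shows "coord d v i (v j) = (if i = j then 1 else 0)"
proof -
  have "v i = v j \<longleftrightarrow> i = j"
    using assms by (auto simp: indexed_basis_def inj_on_def)
  then show ?thesis
    using assms by (simp add: indexed_basis_def coord_def representation_basis)
qed

lemma sum_coord:
  assumes "indexed_basis d v"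
  shows "(\<Sum>i\<le>d. coord d v i u *s v i) = u"
proof -
  have "(\<Sum>b\<in>v ` {..d}. representation (v ` {..d}) u b *s b) = u"
    using assms by (intro sum_representation_eq) (auto simp: indexed_basis_def)
  then show ?thesis
    using assms by (simp add: indexed_basis_def coord_def sum.reindex)
qed

lemma indexed_basis_nonzero:
  assumes "indexed_basis d v" "i \<le> d"
  shows "v i \<noteq> 0"
  using coord_basis[OF assms assms(2)] coord_zero[OF assms(1)] by fastforce

lemma indexed_basis_dim:
  assumes "indexed_basis d v"
  shows "dim UNIV = Suc d"
proof -
  have "dim UNIV = card (v ` {..d})"
    using assms by (intro dim_eq_card) (auto simp: indexed_basis_def)
  then show ?thesis
    using assms by (simp add: indexed_basis_def card_image)
qed

text \<open>Expanding \<open>u\<close> in the eigenbasis turns \<open>T\<close> into multiplication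
  of each coordinate by its eigenvalue. Operator identities are later read entry by entry through
  this rule.\<close>

lemma coord_eigen:
  assumes "indexed_basis d v" "Vector_Spaces.linear scale scale T"
    "\<And>i. i \<le> d \<Longrightarrow> T (v i) = t i *s v i" "i \<le> d"
  shows "coord d v i (T u) = t i * coord d v i u"
proof -
  interpret T: Vector_Spaces.linear scale scale T by fact
  have sum: "coord d v i (\<Sum>j\<in>J. f j) = (\<Sum>j\<in>J. coord d v i (f j))" for J and f :: "nat \<Rightarrow> 'b"
    by (induction J rule: infinite_finite_induct)
      (auto simp: coord_zero[OF assms(1)] coord_add[OF assms(1)])
  have "T u = T (\<Sum>j\<le>d. coord d v j u *s v j)"
    by (simp add: sum_coord[OF assms(1)])
  also have "\<dots> = (\<Sum>j\<le>d. (coord d v j u * t j) *s v j)"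
    by (simp add: T.sum T.scale assms(3))
  also have "coord d v i \<dots> = (\<Sum>j\<le>d. if i = j then coord d v j u * t j else 0)"
    unfolding sum using assms(4)
    by (intro sum.cong) (auto simp: coord_scale[OF assms(1)] coord_basis[OF assms(1)])
  finally show ?thesis
    using assms(4) by (simp add: mult.commute)
qed

lemma linear_eq_on_basis:
  assumes "indexed_basis d v" "Vector_Spaces.linear scale scale S" "Vector_Spaces.linear scale scale T"
    "\<And>i. i \<le> d \<Longrightarrow> S (v i) = T (v i)"
  shows "S u = T u"
proof -
  interpret S: Vector_Spaces.linear scale scale S by fact
  interpret T: Vector_Spaces.linear scale scale T by fact
  have "S (\<Sum>i\<le>d. coord d v i u *s v i) = T (\<Sum>i\<le>d. coord d v i u *s v i)"
    by (simp add: S.sum T.sum S.scale T.scale assms(4))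
  then show ?thesis
    by (simp add: sum_coord[OF assms(1)])
qed

text \<open>Some coordinate \<open>k\<close> of \<open>u\<close> is nonzero, and computing that
  coordinate of \<open>T u\<close> in two ways forces \<open>c = t k\<close>.\<close>

lemma simple_spectrum_eigenvector:
  assumes "indexed_basis d v" "Vector_Spaces.linear scale scale T"
    "\<And>i. i \<le> d \<Longrightarrow> T (v i) = t i *s v i" "T u = c *s u" "u \<noteq> 0"
  obtains k where "k \<le> d" "c = t k" "coord d v k u \<noteq> 0"
proof -
  have "\<exists>k\<le>d. coord d v k u \<noteq> 0"
  proof (rule ccontr)
    assume "\<not> ?thesis"
    then have "u = 0"
      using sum_coord[OF assms(1), of u] by simp
    with assms(5) show False by simp
  qed
  then obtain k where k: "k \<le> d" "coord d v k u \<noteq> 0" by blast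
  moreover have "c * coord d v k u = t k * coord d v k u"
    using coord_eigen[OF assms(1-3) k(1), of u] by (simp add: assms(4) coord_scale[OF assms(1)])
  ultimately show thesis
    using that[of k] by simp
qed

text \<open>A coordinate of \<open>u\<close> at \<open>i \<noteq> k\<close> could survive only if
  \<open>t i = t k\<close>.\<close>

lemma simple_spectrum_eigenspace:
  assumes "indexed_basis d v" "Vector_Spaces.linear scale scale T"
    "\<And>i. i \<le> d \<Longrightarrow> T (v i) = t i *s v i" "inj_on t {..d}" "k \<le> d" "T u = t k *s u"
  shows "u = coord d v k u *s v k"
proof -
  have "coord d v i u = 0" if "i \<le> d" "i \<noteq> k" for i
  proof -
    have "t k * coord d v i u = t i * coord d v i u"
      using coord_eigen[OF assms(1-3) that(1), of u] by (simp add: assms(6) coord_scale[OF assms(1)])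
    moreover have "t k \<noteq> t i"
      using assms(4,5) that by (auto simp: inj_on_def)
    ultimately show ?thesis by simp
  qed
  then have "(\<Sum>i\<le>d. coord d v i u *s v i) = (\<Sum>i\<le>d. if k = i then coord d v k u *s v k else 0)"
    by (intro sum.cong) auto
  then show ?thesis
    using assms(5) by (simp add: sum_coord[OF assms(1)])
qed

lemma distinct_eigenvalues_independent:
  fixes n :: nat
  assumes "Vector_Spaces.linear scale scale T"
    "\<And>i. i < n \<Longrightarrow> T (w i) = t i *s w i" "\<And>i. i < n \<Longrightarrow> w i \<noteq> 0" "inj_on t {..<n}"
  shows "inj_on w {..<n}" "independent (w ` {..<n})"
proof -
  interpret T: Vector_Spaces.linear scale scale T by fact
  have free: "\<forall>i<n. c i = 0" if "(\<Sum>i<n. c i *s w i) = 0" for c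
    using assms(2-4) that
  proof (induction n arbitrary: c)
    case (Suc n)
    \<comment> \<open>Subtracting \<open>t n\<close> times the relation from its image under
      \<open>T\<close> removes the last term and multiplies the others by
      \<open>t i - t n\<close>.\<close>
    have "0 = T (\<Sum>i<Suc n. c i *s w i) - t n *s (\<Sum>i<Suc n. c i *s w i)"
      using Suc.prems(4) by (simp add: T.zero)
    also have "\<dots> = (\<Sum>i<Suc n. (c i * (t i - t n)) *s w i)"
      by (simp add: T.sum T.add T.scale Suc.prems(1) scale_sum_right sum_subtractf algebra_simps)
    finally have "(\<Sum>i<n. (c i * (t i - t n)) *s w i) = 0" by simp
    moreover have "inj_on t {..<n}"
      using Suc.prems(3) by (rule inj_on_subset) auto
    ultimately have "\<forall>i<n. c i * (t i - t n) = 0"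
      using Suc.IH[of "\<lambda>i. c i * (t i - t n)"] Suc.prems(1,2) by simp
    moreover have "t i \<noteq> t n" if "i < n" for i
      using Suc.prems(3) that by (auto simp: inj_on_def)
    ultimately have c: "\<forall>i<n. c i = 0" by auto
    then have "c n *s w n = 0"
      using Suc.prems(4) by simp
    then have "c n = 0"
      using Suc.prems(2)[of n] by simp
    with c show ?case by (simp add: less_Suc_eq)
  qed simp
  show inj: "inj_on w {..<n}"
  proof (rule inj_onI)
    fix i j
    assume *: "i \<in> {..<n}" "j \<in> {..<n}" "w i = w j"
    then have "t i *s w i = t j *s w i"
      using assms(2) by (metis lessThan_iff)
    then have "t i = t j"
      using assms(3)[of i] * by simp
    then show "i = j"
      using assms(4) * by (auto simp: inj_on_def)
  qed
  show "independent (w ` {..<n})"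
  proof (rule independent_if_scalars_zero)
    fix f x
    assume *: "(\<Sum>x\<in>w ` {..<n}. f x *s x) = 0" "x \<in> w ` {..<n}"
    from *(1) have "(\<Sum>i<n. f (w i) *s w i) = 0"
      by (simp add: sum.reindex[OF inj])
    from free[OF this] *(2) show "f x = 0" by auto
  qed simp
qed

lemma span_invariant:
  assumes "Vector_Spaces.linear scale scale T" "\<And>b. b \<in> B \<Longrightarrow> T b \<in> span B" "v \<in> span B"
  shows "T v \<in> span B"
proof -
  interpret T: Vector_Spaces.linear scale scale T by fact
  show ?thesis
    using assms(3)
  proof (induction rule: span_induct_alt)
    case base
    show ?case by (simp add: T.zero span_zero)
  next
    case (step c x y)
    then show ?case
      by (simp add: T.add T.scale span_add span_scale assms(2))
  qed
qed

section \<open>Polynomials in an operator and existence of eigenvectors\<close>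

definition poly_op :: "('b \<Rightarrow> 'b) \<Rightarrow> 'a poly \<Rightarrow> 'b \<Rightarrow> 'b" where
  "poly_op T p v = (\<Sum>i\<le>degree p. coeff p i *s (T ^^ i) v)"

end

context vector_space
begin

lemma poly_op_altdef:
  assumes "degree p \<le> n"
  shows "poly_op T p v = (\<Sum>i\<le>n. coeff p i *s (T ^^ i) v)"
  unfolding poly_op_def using assms
  by (intro sum.mono_neutral_left) (auto simp: coeff_eq_0)

lemma poly_op_linear_factor:
  assumes "Vector_Spaces.linear scale scale T"
  shows "poly_op T ([:- a, 1:] * q) v = T (poly_op T q v) - a *s poly_op T q v"
proof -
  interpret T: Vector_Spaces.linear scale scale T by fact
  let ?n = "degree q"
  have "degree ([:- a, 1:] * q) \<le> Suc ?n"
    using degree_mult_le[of "[:- a, 1:]" q] by simp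
  \<comment> \<open>The linear factor shifts the coefficients of \<open>q\<close> up by one and
    subtracts \<open>a\<close> times the old ones; the common bound \<open>Suc ?n\<close> leaves
    room for the shift.\<close>
  then have "poly_op T ([:- a, 1:] * q) v =
      (\<Sum>i\<le>Suc ?n. (coeff (pCons 0 q) i - a * coeff q i) *s (T ^^ i) v)"
    by (simp add: poly_op_altdef mult_pCons_left del: sum.atMost_Suc)
  also have "\<dots> = (\<Sum>i\<le>Suc ?n. coeff (pCons 0 q) i *s (T ^^ i) v) -
      a *s (\<Sum>i\<le>Suc ?n. coeff q i *s (T ^^ i) v)"
    by (simp add: scale_left_diff_distrib sum_subtractf scale_sum_right del: sum.atMost_Suc)
  also have "(\<Sum>i\<le>Suc ?n. coeff q i *s (T ^^ i) v) = poly_op T q v"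
    by (simp add: poly_op_altdef[of q "Suc ?n"] del: sum.atMost_Suc)
  also have "(\<Sum>i\<le>Suc ?n. coeff (pCons 0 q) i *s (T ^^ i) v) = T (poly_op T q v)"
    unfolding sum.atMost_Suc_shift by (simp add: poly_op_def T.sum T.scale)
  finally show ?thesis .
qed

text \<open>The \<open>n + 1\<close> vectors \<open>v, T v, ..., T^n v\<close> cannot be independent
  in a space spanned by \<open>n\<close> vectors. Either two of them agree, and a difference of
  monomials annihilates \<open>v\<close>, or a linear dependence supplies the coefficients.\<close>

lemma annihilating_poly:
  assumes "fin_dim"
  obtains p where "p \<noteq> 0" "poly_op T p v = 0"
proof -
  obtain S where S: "finite S" "span S = UNIV"
    using assms unfolding fin_dim_def by blast
  define n where "n = card S"
  let ?g = "\<lambda>i. (T ^^ i) v"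
  show thesis
  proof (cases "inj_on ?g {..n}")
    case False
    then obtain i j where ij: "i \<noteq> j" "?g i = ?g j"
      by (auto simp: inj_on_def)
    define p where "p = monom (1::'a) i - monom 1 j"
    have "coeff p i \<noteq> 0"
      using ij(1) by (simp add: p_def)
    then have "p \<noteq> 0" by auto
    moreover have "degree p \<le> max i j"
      unfolding p_def by (rule degree_diff_le_max[THEN order_trans]) (simp add: degree_monom_eq)
    then have "poly_op T p v = (\<Sum>k\<le>max i j. coeff p k *s ?g k)"
      by (rule poly_op_altdef)
    then have "poly_op T p v =
        (\<Sum>k\<le>max i j. if i = k then ?g i else 0) - (\<Sum>k\<le>max i j. if j = k then ?g j else 0)"
      unfolding sum_subtractf[symmetric] using ij(1)
      by (auto simp: p_def intro!: sum.cong)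
    then have "poly_op T p v = 0"
      using ij(2) by simp
    ultimately show thesis by (rule that)
  next
    case True
    have "dependent (?g ` {..n})"
    proof (rule ccontr)
      assume "independent (?g ` {..n})"
      from independent_span_bound[OF S(1) this] S(2) have "card (?g ` {..n}) \<le> n"
        by (simp add: n_def)
      with card_image[OF True] show False by simp
    qed
    then obtain u where u: "\<exists>x\<in>?g ` {..n}. u x \<noteq> 0" "(\<Sum>x\<in>?g ` {..n}. u x *s x) = 0"
      by (subst (asm) dependent_finite) auto
    define p where "p = (\<Sum>i\<le>n. monom (u (?g i)) i)"
    have coeff: "coeff p i = (if i \<le> n then u (?g i) else 0)" for i
      by (simp add: p_def coeff_sum)
    have "p \<noteq> 0"
    proof
      assume "p = 0"
      then have "u (?g i) = 0" if "i \<le> n" for i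
        using coeff[of i] that by simp
      with u(1) show False by auto
    qed
    moreover have "poly_op T p v = (\<Sum>i\<le>n. coeff p i *s ?g i)"
      by (intro poly_op_altdef degree_le) (simp add: coeff)
    then have "poly_op T p v = 0"
      using u(2) by (simp add: coeff sum.reindex[OF True])
    ultimately show thesis by (rule that)
  qed
qed

end

text \<open>Split a root \<open>a\<close> off a polynomial annihilating \<open>v\<close>. With
  \<open>q\<close> the cofactor, either \<open>q(T) v\<close> is an eigenvector for
  \<open>a\<close>, or \<open>q\<close> annihilates \<open>v\<close> and has smaller degree.
  Invariance keeps every \<open>q(T) v\<close> in \<open>W\<close>.\<close>

lemma eigenvector_exists:
  fixes scale :: "'k::alg_closed_field \<Rightarrow> 'v::ab_group_add \<Rightarrow> 'v" (infixr \<open>*s\<close> 75)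
  assumes "Vector_Spaces.linear scale scale T" "vector_space.fin_dim scale"
    "module.subspace scale W" "\<And>u. u \<in> W \<Longrightarrow> T u \<in> W" "v \<in> W" "v \<noteq> 0"
  obtains c u where "u \<in> W" "u \<noteq> 0" "T u = c *s u"
proof -
  interpret T: Vector_Spaces.linear scale scale T by fact
  have inW: "T.vs1.poly_op T q v \<in> W" for q
  proof -
    have "(T ^^ i) v \<in> W" for i
      by (induction i) (auto intro: assms)
    then show ?thesis
      unfolding T.vs1.poly_op_def
      by (intro T.vs1.subspace_sum[OF assms(3)] T.vs1.subspace_scale[OF assms(3)])
  qed
  obtain p where "p \<noteq> 0" "T.vs1.poly_op T p v = 0"
    using T.vs1.annihilating_poly[OF assms(2)] by blast
  then show thesis
  proof (induction "degree p" arbitrary: p rule: less_induct)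
    case less
    have "degree p > 0"
    proof (rule ccontr)
      assume "\<not> degree p > 0"
      then obtain a where "p = [:a:]"
        by (auto elim: degree_eq_zeroE)
      with less.prems assms(6) show False
        by (simp add: T.vs1.poly_op_def)
    qed
    then obtain a where "poly p a = 0"
      using alg_closed_imp_poly_has_root by blast
    then obtain q where q: "p = [:- a, 1:] * q"
      by (auto simp: poly_eq_0_iff_dvd)
    let ?u = "T.vs1.poly_op T q v"
    show thesis
    proof (cases "?u = 0")
      case False
      moreover have "T ?u = a *s ?u"
        using less.prems(2) T.vs1.poly_op_linear_factor[OF assms(1), of a q v]
        by (simp add: q del: mult_pCons_left)
      ultimately show thesis
        using that inW by blast
    next
      case True
      have "q \<noteq> 0"
        using less.prems(1) q by auto
      then have "degree q < degree p"
        unfolding q by (subst degree_mult_eq) auto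
      from less.hyps[OF this \<open>q \<noteq> 0\<close> True] show thesis .
    qed
  qed
qed

section \<open>Rescaling the operators\<close>

context vector_space
begin

lemma mat_of_scale:
  assumes "indexed_basis d v"
  shows "mat_of d v (\<lambda>u. c *s T u) i j = c * mat_of d v T i j"
  by (simp add: mat_of_coord coord_scale[OF assms])

lemma diag_tridiag_basis_scale:
  assumes "a \<noteq> 0" "b \<noteq> 0"
  shows "diag_tridiag_basis (\<lambda>u. a *s S u) (\<lambda>u. b *s T u) d v \<longleftrightarrow> diag_tridiag_basis S T d v"
  using assms
  by (auto simp: diag_tridiag_basis_def diagonal_mat_def irreducible_tridiagonal_mat_def
      tridiagonal_mat_def mat_of_scale)

lemma bipartite_mat_scale:
  assumes "c \<noteq> 0" "indexed_basis d v"
  shows "bipartite_mat d (mat_of d v (\<lambda>u. c *s T u)) \<longleftrightarrow> bipartite_mat d (mat_of d v T)"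
    and "almost_bipartite_mat d (mat_of d v (\<lambda>u. c *s T u)) \<longleftrightarrow> almost_bipartite_mat d (mat_of d v T)"
  using assms by (auto simp: bipartite_mat_def almost_bipartite_mat_def mat_of_scale)

lemma linear_scaled:
  assumes "Vector_Spaces.linear scale scale T"
  shows "Vector_Spaces.linear scale scale (\<lambda>u. c *s T u)"
proof -
  interpret T: Vector_Spaces.linear scale scale T by fact
  show ?thesis
    by unfold_locales (simp_all add: T.add T.scale scale_right_distrib mult.commute)
qed

end

section \<open>Chains of eigenvectors\<close>

text \<open>Only the operators of the three generators are kept, so that symmetries of the relations
  become further interpretations of the same locale and results transfer along them.\<close>

locale anticommutator_triple = vector_space scale
  for scale :: "'k::{alg_closed_field, field_char_0} \<Rightarrow> 'v::ab_group_add \<Rightarrow> 'v" (infixr \<open>*s\<close> 75) +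
  fixes X Y Z :: "'v \<Rightarrow> 'v"
  assumes linear_X: "Vector_Spaces.linear scale scale X"
    and linear_Y: "Vector_Spaces.linear scale scale Y"
    and linear_Z: "Vector_Spaces.linear scale scale Z"
    and XY: "X (Y v) + Y (X v) = 2 *s Z v"
    and YZ: "Y (Z v) + Z (Y v) = 2 *s X v"
    and ZX: "Z (X v) + X (Z v) = 2 *s Y v"
    and finite_dimensional: "fin_dim"
    and nontrivial: "(UNIV :: 'v set) \<noteq> {0}"
    and irreducible: "subspace W \<Longrightarrow> (\<And>w. w \<in> W \<Longrightarrow> X w \<in> W) \<Longrightarrow> (\<And>w. w \<in> W \<Longrightarrow> Y w \<in> W) \<Longrightarrow>
      (\<And>w. w \<in> W \<Longrightarrow> Z w \<in> W) \<Longrightarrow> W = {0} \<or> W = UNIV"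
begin

sublocale X: Vector_Spaces.linear scale scale X by (rule linear_X)
sublocale Y: Vector_Spaces.linear scale scale Y by (rule linear_Y)
sublocale Z: Vector_Spaces.linear scale scale Z by (rule linear_Z)

definition R :: "'v \<Rightarrow> 'v" where "R v = Y v + Z v"
definition L :: "'v \<Rightarrow> 'v" where "L v = Y v - Z v"

lemma linear_R: "Vector_Spaces.linear scale scale R"
  by unfold_locales (simp_all add: R_def Y.add Z.add Y.scale Z.scale algebra_simps)

lemma linear_L: "Vector_Spaces.linear scale scale L"
  by unfold_locales (simp_all add: L_def Y.add Z.add Y.scale Z.scale algebra_simps)

sublocale R: Vector_Spaces.linear scale scale R by (rule linear_R)
sublocale L: Vector_Spaces.linear scale scale L by (rule linear_L)

lemma scale_2: "2 *s v = v + v"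
  by (metis one_add_one scale_left_distrib scale_one)

text \<open>The sum of the relations \<open>XY\<close> and \<open>ZX\<close>; their difference gives
  \<open>X_L\<close>.\<close>

lemma X_R: "X (R v) = 2 *s R v - R (X v)"
  using XY[of v] ZX[of v] by (simp add: R_def X.add scale_right_distrib algebra_simps)

lemma X_L: "X (L v) = - (2 *s L v) - L (X v)"
  by (simp add: L_def X.diff scale_right_diff_distrib XY[symmetric] ZX[symmetric] algebra_simps)

lemma R_R: "R (R v) = L (L v) + 4 *s X v"
proof -
  have "R (R v) = L (L v) + 2 *s (Y (Z v) + Z (Y v))"
    by (simp add: R_def L_def Y.add Z.add Y.diff Z.diff scale_2 algebra_simps)
  then show ?thesis by (simp add: YZ)
qed

definition eigenvalue :: "'k \<Rightarrow> bool" where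
  "eigenvalue c \<longleftrightarrow> (\<exists>u. u \<noteq> 0 \<and> X u = c *s u)"

text \<open>\<open>step i\<close> moves a chain from position \<open>i\<close> to
  \<open>i + 1\<close>; \<open>step (Suc i)\<close> is the other one of \<open>L\<close> and
  \<open>R\<close> and leads back.\<close>

definition step :: "nat \<Rightarrow> 'v \<Rightarrow> 'v" where
  "step i = (if even i then L else R)"

primrec chain :: "'v \<Rightarrow> nat \<Rightarrow> 'v" where
  "chain w 0 = w"
| "chain w (Suc i) = step i (chain w i)"

text \<open>The orbit of \<open>\<theta>\<close> under the reflections
  \<open>c \<mapsto> - 2 - c\<close> (from \<open>L\<close>) and \<open>c \<mapsto> 2 - c\<close>
  (from \<open>R\<close>), applied alternately.\<close>

definition ev :: "'k \<Rightarrow> nat \<Rightarrow> 'k" where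
  "ev \<theta> i = (- 1) ^ i * (\<theta> + 2 * of_nat i)"

lemma chain_eigenvector:
  assumes "X w = \<theta> *s w"
  shows "X (chain w i) = ev \<theta> i *s chain w i"
proof (induction i)
  case (Suc i)
  show ?case
  proof (cases "even i")
    case True
    then have "X (chain w (Suc i)) = (- 2 - ev \<theta> i) *s chain w (Suc i)"
      by (simp add: step_def X_L Suc L.scale algebra_simps)
    also have "- 2 - ev \<theta> i = ev \<theta> (Suc i)"
      using True by (simp add: ev_def algebra_simps)
    finally show ?thesis .
  next
    case False
    then have "X (chain w (Suc i)) = (2 - ev \<theta> i) *s chain w (Suc i)"
      by (simp add: step_def X_R Suc R.scale algebra_simps)
    also have "2 - ev \<theta> i = ev \<theta> (Suc i)"
      using False by (simp add: ev_def algebra_simps)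
    finally show ?thesis .
  qed
qed (simp add: ev_def assms)

lemma chain_nonzero:
  assumes "chain w j \<noteq> 0" "i \<le> j"
  shows "chain w i \<noteq> 0"
proof
  assume "chain w i = 0"
  with assms(2) have "chain w j = 0"
    by (induction rule: dec_induct) (auto simp: step_def L.zero R.zero)
  with assms(1) show False ..
qed

text \<open>If two eigenvalues along the chain coincide, then \<open>\<theta>\<close> is minus an odd number and the
  eigenvalue halfway between them is \<open>1\<close> or \<open>-1\<close>.\<close>

lemma chain_eigenvalues_distinct:
  assumes "X w = \<theta> *s w" "\<theta> = 1 \<or> \<not> eigenvalue 1 \<and> \<not> eigenvalue (- 1)"
    "i < j" "chain w j \<noteq> 0"
  shows "ev \<theta> i \<noteq> ev \<theta> j"
proof
  assume eq: "ev \<theta> i = ev \<theta> j"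
  show False
  proof (cases "even i \<longleftrightarrow> even j")
    case True
    then have "(of_nat i :: 'k) = of_nat j"
      using eq by (cases "even j") (auto simp: ev_def)
    with assms(3) show False by simp
  next
    case False
    then have "2 * (\<theta> + of_nat (i + j)) = 0"
      using eq by (cases "even j") (auto simp: ev_def algebra_simps eq_neg_iff_add_eq_0)
    then have \<theta>: "\<theta> + of_nat (i + j) = 0"
      unfolding mult_eq_0_iff by simp
    \<comment> \<open>For \<open>\<theta> = 1\<close> the sum would be a positive integer, which is
      nonzero in characteristic zero.\<close>
    have "\<theta> \<noteq> 1"
    proof
      assume "\<theta> = 1"
      with \<theta> have "(of_nat (Suc (i + j)) :: 'k) = 0" by simp
      then show False by (simp only: of_nat_eq_0_iff)
    qed
    have "odd (i + j)"
      using False by simp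
    then obtain k where k: "i + j = 2 * k + 1"
      by (rule oddE)
    have "\<theta> + 2 * of_nat k = - 1"
      using \<theta> unfolding k by (simp add: eq_neg_iff_add_eq_0 add.commute add.left_commute)
    then have "ev \<theta> k = 1 \<or> ev \<theta> k = - 1"
      by (cases "even k") (auto simp: ev_def)
    moreover have "chain w k \<noteq> 0"
      using k assms(3) by (intro chain_nonzero[OF assms(4)]) simp
    ultimately have "eigenvalue 1 \<or> eigenvalue (- 1)"
      using chain_eigenvector[OF assms(1), of k] unfolding eigenvalue_def by metis
    with assms(2) \<open>\<theta> \<noteq> 1\<close> show False by blast
  qed
qed

lemma chain_inj_ev:
  assumes "X w = \<theta> *s w" "\<theta> = 1 \<or> \<not> eigenvalue 1 \<and> \<not> eigenvalue (- 1)"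
    "\<And>i. i \<le> d \<Longrightarrow> chain w i \<noteq> 0"
  shows "inj_on (ev \<theta>) {..d}"
  using chain_eigenvalues_distinct[OF assms(1,2)] assms(3)
  by (intro linorder_inj_onI) (auto simp: linear)

text \<open>A chain that never vanishes would contain more independent eigenvectors than a finite
  spanning set allows.\<close>

lemma chain_terminates:
  assumes "X w = \<theta> *s w" "\<theta> = 1 \<or> \<not> eigenvalue 1 \<and> \<not> eigenvalue (- 1)" "w \<noteq> 0"
  obtains d where "\<And>i. i \<le> d \<Longrightarrow> chain w i \<noteq> 0" "chain w (Suc d) = 0"
proof -
  have "\<exists>n. chain w n = 0"
  proof (rule ccontr)
    assume "\<not> ?thesis"
    then have nz: "chain w i \<noteq> 0" for i by blast
    obtain S where S: "finite S" "span S = UNIV"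
      using finite_dimensional unfolding fin_dim_def by blast
    define n where "n = Suc (card S)"
    have "inj_on (ev \<theta>) {..<n}"
      unfolding n_def lessThan_Suc_atMost by (rule chain_inj_ev[OF assms(1,2) nz])
    from distinct_eigenvalues_independent[OF linear_X chain_eigenvector[OF assms(1)] nz this]
    have "inj_on (chain w) {..<n}" "independent (chain w ` {..<n})" .
    with independent_span_bound[OF S(1) this(2)] S(2) show False
      by (simp add: card_image n_def)
  qed
  then have n: "chain w (LEAST n. chain w n = 0) = 0" by (rule LeastI_ex)
  \<comment> \<open>The least vanishing index is positive because \<open>chain w 0 = w\<close> is
    nonzero.\<close>
  then obtain d where d: "(LEAST n. chain w n = 0) = Suc d"
    using assms(3) by (cases "LEAST n. chain w n = 0") auto
  show thesis
  proof
    show "chain w (Suc d) = 0" using n d by simp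
    fix i assume "i \<le> d"
    then show "chain w i \<noteq> 0"
      using not_less_Least[of i "\<lambda>n. chain w n = 0"] d by simp
  qed
qed

text \<open>For \<open>i > 0\<close>, the factor with which \<open>step (Suc i)\<close> carries
  \<open>chain w i\<close> back to \<open>chain w (i - 1)\<close> when
  \<open>R w = \<mu> *s w\<close>. It starts at \<open>\<mu>^2\<close>, the eigenvalue of
  \<open>R^2\<close> on \<open>w\<close>, and grows by
  \<open>4 * (- 1) ^ Suc i * ev \<theta> i\<close> from \<open>i\<close> to
  \<open>i + 1\<close>.\<close>

definition lower_coeff :: "'k \<Rightarrow> 'k \<Rightarrow> nat \<Rightarrow> 'k" where
  "lower_coeff \<theta> \<mu> i = \<mu>\<^sup>2 - 4 * of_nat i * (\<theta> + of_nat i - 1)"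

lemma step_step: "step (Suc i) (step (Suc i) v) = step i (step i v) - (4 * (- 1) ^ Suc i) *s X v"
  by (simp add: step_def R_R algebra_simps)

text \<open>The two equations are proved alternately: \<open>step_step\<close> turns the second at
  \<open>i\<close> into the first at \<open>i\<close>, and applying \<open>step i\<close> to the
  first gives the second at \<open>i + 1\<close>.\<close>

lemma step_step_chain:
  assumes "X w = \<theta> *s w" "R w = \<mu> *s w"
  shows "step i (step i (chain w i)) = lower_coeff \<theta> \<mu> (Suc i) *s chain w i"
    and "step (Suc i) (step (Suc i) (chain w i)) = lower_coeff \<theta> \<mu> i *s chain w i"
proof -
  have sq: "step i (step i v) = step (Suc i) (step (Suc i) v) + (4 * (- 1) ^ Suc i) *s X v" for i v
    by (simp add: step_step)
  have fst: "step i (step i (chain w i)) = lower_coeff \<theta> \<mu> (Suc i) *s chain w i"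
    if "step (Suc i) (step (Suc i) (chain w i)) = lower_coeff \<theta> \<mu> i *s chain w i" for i
  proof -
    have "step i (step i (chain w i)) =
        (lower_coeff \<theta> \<mu> i + 4 * (- 1) ^ Suc i * ev \<theta> i) *s chain w i"
      unfolding sq[of i] that chain_eigenvector[OF assms(1)] by (simp add: scale_left_distrib scale_left_diff_distrib)
    also have "lower_coeff \<theta> \<mu> i + 4 * (- 1) ^ Suc i * ev \<theta> i = lower_coeff \<theta> \<mu> (Suc i)"
      by (cases "even i") (simp_all add: lower_coeff_def ev_def algebra_simps)
    finally show ?thesis .
  qed
  have lin: "step i (c *s v) = c *s step i v" for i c v
    by (simp add: step_def L.scale R.scale)
  show snd: "step (Suc i) (step (Suc i) (chain w i)) = lower_coeff \<theta> \<mu> i *s chain w i"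
  proof (induction i)
    case 0
    show ?case by (simp add: step_def lower_coeff_def assms(2) R.scale power2_eq_square)
  next
    case (Suc i)
    have "step (Suc (Suc i)) = step i" by (simp add: step_def)
    then show ?case
      using fst[OF Suc] by (simp add: lin)
  qed
  show "step i (step i (chain w i)) = lower_coeff \<theta> \<mu> (Suc i) *s chain w i"
    by (rule fst[OF snd])
qed

section \<open>The Casimir operator and the standard basis\<close>

definition casimir :: "'v \<Rightarrow> 'v" where
  "casimir v = X (X v) + Y (Y v) + Z (Z v)"

lemma linear_casimir: "Vector_Spaces.linear scale scale casimir"
  by unfold_locales
    (simp_all add: casimir_def X.add Y.add Z.add X.scale Y.scale Z.scale algebra_simps)

text \<open>\<open>R^2 + L^2 = 2 (Y^2 + Z^2)\<close>, and \<open>step i\<close>,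
  \<open>step (Suc i)\<close> are \<open>L\<close> and \<open>R\<close> in some order.\<close>

lemma casimir_step:
  "2 *s casimir v = 2 *s X (X v) + step i (step i v) + step (Suc i) (step (Suc i) v)"
  by (simp add: casimir_def step_def R_def L_def Y.add Z.add Y.diff Z.diff scale_2 algebra_simps)

lemma Y_step: "2 *s Y v = step i v + step (Suc i) v"
  by (simp add: step_def R_def L_def scale_2 algebra_simps)

lemma Z_step: "2 *s Z v = R v - L v"
  by (simp add: R_def L_def scale_2 algebra_simps)

text \<open>The alternatives use only squares of eigenvalues, the matrix of \<open>Y\<close> and the
  Casimir operator, so that they survive the sign change of \<open>X\<close> and
  \<open>Z\<close>.\<close>

definition standard_basis :: "nat \<Rightarrow> (nat \<Rightarrow> 'v) \<Rightarrow> (nat \<Rightarrow> 'k) \<Rightarrow> bool" where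
  "standard_basis d w t \<longleftrightarrow> indexed_basis d w \<and> (\<forall>i\<le>d. X (w i) = t i *s w i) \<and> inj_on t {..d} \<and>
     irreducible_tridiagonal_mat d (mat_of d w Y) \<and>
     ((t 0)\<^sup>2 = 1 \<and> (\<forall>i\<le>d. (t i)\<^sup>2 = 1 \<longrightarrow> i = 0) \<and> mat_of d w Y 0 0 \<noteq> 0 \<and>
        (\<forall>v. casimir v = (4 * (of_nat (Suc d))\<^sup>2 - 1) *s v) \<or>
      (\<forall>i\<le>d. (t i)\<^sup>2 \<noteq> 1) \<and> (\<forall>v. casimir v = ((of_nat (Suc d))\<^sup>2 - 1) *s v))"

text \<open>The nonzero part of the chain spans an invariant subspace, hence everything. Its
  vanishing at \<open>Suc d\<close> then determines \<open>\<mu>^2\<close> or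
  \<open>\<theta>\<close> from \<open>d\<close>, and with these values the return factors inside the
  chain are nonzero.\<close>

lemma standard_basis_chain:
  assumes Xw: "X w = \<theta> *s w" and Rw: "R w = \<mu> *s w" and "w \<noteq> 0"
    and \<theta>: "\<theta> = 1 \<or> \<not> eigenvalue 1 \<and> \<not> eigenvalue (- 1)"
  obtains d where "standard_basis d (chain w) (ev \<theta>)"
proof -
  obtain d where nz: "\<And>i. i \<le> d \<Longrightarrow> chain w i \<noteq> 0" and last: "chain w (Suc d) = 0"
    using chain_terminates[OF Xw \<theta> \<open>w \<noteq> 0\<close>] by blast
  let ?c = "chain w"
  let ?B = "?c ` {..d}"
  note Xc = chain_eigenvector[OF Xw]
  note steps = step_step_chain[OF Xw Rw]
  have inj: "inj_on (ev \<theta>) {..d}"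
    by (rule chain_inj_ev[OF Xw \<theta> nz])
  have indep: "inj_on ?c {..d}" "independent ?B"
    using distinct_eigenvalues_independent[OF linear_X, of "Suc d" ?c "ev \<theta>"] Xc nz inj
    by (auto simp: lessThan_Suc_atMost)
  have back_step: "step (Suc i) (?c i) = (if i = 0 then \<mu> *s w else lower_coeff \<theta> \<mu> i *s ?c (i - 1))" for i
  proof (cases i)
    case (Suc k)
    have "step (Suc (Suc k)) = step k" by (simp add: step_def)
    then show ?thesis
      using steps(1)[of k] Suc by simp
  qed (simp add: step_def Rw)

  have c_span: "?c i \<in> span ?B" if "i \<le> Suc d" for i
    using that last by (cases "i = Suc d") (auto simp: span_zero simp del: chain.simps intro: span_base)
  have step_span: "step i (?c i) \<in> span ?B" "step (Suc i) (?c i) \<in> span ?B" if "i \<le> d" for i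
    using that c_span[of "Suc i"] c_span[of "i - 1"] c_span[of 0]
    by (auto simp: back_step intro: span_scale)
  have R_span: "R v \<in> span ?B" and L_span: "L v \<in> span ?B" if "v \<in> span ?B" for v
  proof -
    have "R (?c i) \<in> span ?B" "L (?c i) \<in> span ?B" if "i \<le> d" for i
      using step_span[OF that] by (auto simp: step_def split: if_splits)
    then show "R v \<in> span ?B" "L v \<in> span ?B"
      using that by (auto intro: span_invariant[OF linear_R] span_invariant[OF linear_L])
  qed
  have "span ?B = {0} \<or> span ?B = UNIV"
  proof (rule irreducible)
    fix v
    assume v: "v \<in> span ?B"
    have half: "u \<in> span ?B" if "2 *s u \<in> span ?B" for u
      using span_scale[OF that, of "1/2"] by simp
    have "X b \<in> span ?B" if "b \<in> ?B" for b
      using span_scale[OF span_base[OF that]] that Xc by auto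
    then show "X v \<in> span ?B"
      using v by (rule span_invariant[OF linear_X])
    show "Y v \<in> span ?B"
      using span_add[OF L_span[OF v] R_span[OF v]] by (subst half) (simp_all add: Y_step[of v 0] step_def)
    show "Z v \<in> span ?B"
      using span_diff[OF R_span[OF v] L_span[OF v]] by (subst half) (simp_all add: Z_step)
  qed simp
  moreover have "?c 0 \<in> span ?B" by (rule c_span) simp
  ultimately have "span ?B = UNIV"
    using \<open>w \<noteq> 0\<close> by auto
  with indep have basis: "indexed_basis d ?c"
    by (simp add: indexed_basis_def)

  \<comment> \<open>Going forward from the last vector and back again passes through zero.\<close>
  have "lower_coeff \<theta> \<mu> (Suc d) *s ?c d = 0"
    using steps(1)[of d] last by (simp add: step_def L.zero R.zero split: if_splits)
  then have end0: "lower_coeff \<theta> \<mu> (Suc d) = 0"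
    using nz[of d] by simp
  have one: "\<mu>\<^sup>2 = 4 * (of_nat (Suc d))\<^sup>2" if "\<theta> = 1"
    using end0 that by (simp add: lower_coeff_def power2_eq_square algebra_simps)
  have not_one: "\<mu> = 0" "\<theta> = - of_nat d" if "\<theta> \<noteq> 1"
  proof -
    \<comment> \<open>\<open>R\<close> sends \<open>w\<close> into the eigenspace of
      \<open>2 - \<theta>\<close>, so \<open>R w = \<mu> *s w\<close> leaves only
      \<open>\<mu> = 0\<close> when \<open>\<theta> \<noteq> 1\<close>.\<close>
    have "(\<mu> * \<theta>) *s w = (2 * \<mu> - \<mu> * \<theta>) *s w"
      using X_R[of w] by (simp add: Xw Rw X.scale R.scale scale_left_diff_distrib mult.commute)
    then have "\<mu> * \<theta> = 2 * \<mu> - \<mu> * \<theta>"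
      using \<open>w \<noteq> 0\<close> by simp
    then have "2 * (\<mu> * (\<theta> - 1)) = 0" by (simp add: algebra_simps)
    then show "\<mu> = 0" using that by simp
    then have "of_nat (Suc d) * (\<theta> + of_nat d) = 0"
      using end0 by (simp add: lower_coeff_def del: of_nat_Suc) (simp add: algebra_simps)
    then have "\<theta> + of_nat d = 0"
      unfolding mult_eq_0_iff of_nat_eq_0_iff by simp
    then show "\<theta> = - of_nat d" by (simp add: eq_neg_iff_add_eq_0)
  qed
  \<comment> \<open>With the values just found the factor is \<open>4 ((d + 1)^2 - i^2)\<close> or
    \<open>4 i (d + 1 - i)\<close>.\<close>
  have back_nz: "lower_coeff \<theta> \<mu> i \<noteq> 0" if "i \<noteq> 0" "i \<le> d" for i
  proof (cases "\<theta> = 1")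
    case True
    have "lower_coeff \<theta> \<mu> i = 4 * of_nat (Suc d - i) * of_nat (Suc d + i)"
      using that one[OF True] True
      by (simp add: lower_coeff_def of_nat_diff power2_eq_square algebra_simps)
    then show ?thesis
      using that by (simp del: of_nat_add of_nat_Suc)
  next
    case False
    have "lower_coeff \<theta> \<mu> i = 4 * of_nat i * of_nat (Suc d - i)"
      using that by (simp add: lower_coeff_def not_one[OF False] of_nat_diff algebra_simps)
    then show ?thesis
      using that by (simp del: of_nat_add of_nat_Suc)
  qed

  \<comment> \<open>\<open>2 Y\<close> is the forward plus the backward step. The forward one gives
    the subdiagonal ones; the backward one gives the superdiagonal and, at the first vector, the
    corner entry \<open>\<mu>\<close>.\<close>
  have mat: "2 * mat_of d ?c Y i j = (if i = Suc j then 1 else 0) +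
      (if j = 0 then (if i = 0 then \<mu> else 0) else if Suc i = j then lower_coeff \<theta> \<mu> j else 0)"
    if "i \<le> d" "j \<le> d" for i j
  proof -
    have "2 * mat_of d ?c Y i j = coord d ?c i (step j (?c j)) + coord d ?c i (step (Suc j) (?c j))"
      unfolding mat_of_coord coord_scale[OF basis, symmetric] coord_add[OF basis, symmetric]
        Y_step[of _ j] ..
    moreover have "coord d ?c i (step j (?c j)) = (if i = Suc j then 1 else 0)"
    proof (cases "j = d")
      case True
      then show ?thesis
        using that last by (simp add: coord_zero[OF basis])
    next
      case False
      then have "coord d ?c i (?c (Suc j)) = (if i = Suc j then 1 else 0)"
        using that by (intro coord_basis[OF basis]) auto
      then show ?thesis by simp
    qed
    moreover have "coord d ?c i (step (Suc j) (?c j)) =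
        (if j = 0 then (if i = 0 then \<mu> else 0) else if Suc i = j then lower_coeff \<theta> \<mu> j else 0)"
      using that coord_basis[OF basis that(1), of 0] coord_basis[OF basis that(1), of "j - 1"]
      by (auto simp: back_step coord_scale[OF basis])
    ultimately show ?thesis by simp
  qed
  have "irreducible_tridiagonal_mat d (mat_of d ?c Y)"
    unfolding irreducible_tridiagonal_mat_def tridiagonal_mat_def
  proof (intro conjI allI impI)
    fix i j
    assume "i \<le> d" "j \<le> d" "Suc i < j \<or> Suc j < i"
    then show "mat_of d ?c Y i j = 0"
      using mat[of i j] by (auto split: if_splits)
  next
    fix i
    assume "i < d"
    then show "mat_of d ?c Y i (Suc i) \<noteq> 0" "mat_of d ?c Y (Suc i) i \<noteq> 0"
      using mat[of i "Suc i"] mat[of "Suc i" i] back_nz[of "Suc i"] by (auto split: if_splits)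
  qed

  \<comment> \<open>On \<open>chain w i\<close>, the change of the two return factors with
    \<open>i\<close> cancels that of \<open>2 (ev \<theta> i)^2\<close>, so one scalar serves for
    the whole basis.\<close>
  moreover have casimir: "casimir v = ((\<theta> - 1)\<^sup>2 + \<mu>\<^sup>2 - 1) *s v" for v
  proof (rule linear_eq_on_basis[OF basis linear_casimir])
    show "Vector_Spaces.linear scale scale ((*s) ((\<theta> - 1)\<^sup>2 + \<mu>\<^sup>2 - 1))"
      by (rule linear_scale_self)
    fix i
    have "2 *s casimir (?c i) = (2 * (ev \<theta> i)\<^sup>2 + lower_coeff \<theta> \<mu> (Suc i) + lower_coeff \<theta> \<mu> i) *s ?c i"
      unfolding casimir_step[of _ i] steps
      by (simp add: Xc X.scale scale_left_distrib power2_eq_square)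
    also have "2 * (ev \<theta> i)\<^sup>2 + lower_coeff \<theta> \<mu> (Suc i) + lower_coeff \<theta> \<mu> i = 2 * ((\<theta> - 1)\<^sup>2 + \<mu>\<^sup>2 - 1)"
      by (simp add: ev_def lower_coeff_def power_mult_distrib power2_eq_square algebra_simps)
    finally have "2 *s casimir (?c i) = 2 *s ((\<theta> - 1)\<^sup>2 + \<mu>\<^sup>2 - 1) *s ?c i" by simp
    then show "casimir (?c i) = ((\<theta> - 1)\<^sup>2 + \<mu>\<^sup>2 - 1) *s ?c i"
      unfolding scale_cancel_left by simp
  qed

  moreover have "(ev \<theta> 0)\<^sup>2 = 1 \<and> (\<forall>i\<le>d. (ev \<theta> i)\<^sup>2 = 1 \<longrightarrow> i = 0) \<and> mat_of d ?c Y 0 0 \<noteq> 0 \<and>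
        (\<forall>v. casimir v = (4 * (of_nat (Suc d))\<^sup>2 - 1) *s v)" if "\<theta> = 1"
  proof (intro conjI allI impI)
    fix i assume "(ev \<theta> i)\<^sup>2 = 1"
    then have "(1 + 2 * of_nat i :: 'k)\<^sup>2 = 1"
      using that by (simp add: ev_def power_mult_distrib flip: power_even_eq)
    \<comment> \<open>\<open>(1 + 2 i)^2 - 1 = 4 i (i + 1)\<close>.\<close>
    then have "4 * (of_nat i * of_nat (Suc i)) = (0::'k)"
      by (simp add: power2_eq_square algebra_simps)
    then show "i = 0"
      by (simp del: of_nat_Suc)
  next
    have "\<mu> \<noteq> 0"
      using one[OF that] by (auto simp del: of_nat_Suc)
    then show "mat_of d ?c Y 0 0 \<noteq> 0"
      using mat[of 0 0] by auto
  next
    fix v show "casimir v = (4 * (of_nat (Suc d))\<^sup>2 - 1) *s v"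
      unfolding casimir one[OF that] using that by simp
  qed (simp add: that ev_def)
  moreover have "(\<forall>i\<le>d. (ev \<theta> i)\<^sup>2 \<noteq> 1) \<and> (\<forall>v. casimir v = ((of_nat (Suc d))\<^sup>2 - 1) *s v)"
    if "\<theta> \<noteq> 1"
  proof (intro conjI allI impI notI)
    fix i assume "i \<le> d" "(ev \<theta> i)\<^sup>2 = 1"
    then have "ev \<theta> i = 1 \<or> ev \<theta> i = - 1" by (simp add: power2_eq_1_iff)
    then have "eigenvalue 1 \<or> eigenvalue (- 1)"
      using nz[OF \<open>i \<le> d\<close>] Xc[of i] unfolding eigenvalue_def by metis
    with \<theta> that show False by blast
  next
    fix v
    have "(\<theta> - 1)\<^sup>2 + \<mu>\<^sup>2 - 1 = (of_nat (Suc d))\<^sup>2 - 1"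
      by (simp add: not_one[OF that] power2_eq_square algebra_simps)
    then show "casimir v = ((of_nat (Suc d))\<^sup>2 - 1) *s v"
      unfolding casimir by simp
  qed
  ultimately have "standard_basis d ?c (ev \<theta>)"
    unfolding standard_basis_def using basis Xc inj by blast
  then show thesis by (rule that)
qed

section \<open>Arbitrary diagonalizing bases\<close>

lemma flipped: "anticommutator_triple scale (\<lambda>v. - X v) Y (\<lambda>v. - Z v)"
proof
  show "W = {0} \<or> W = UNIV"
    if W: "subspace W" "\<And>w. w \<in> W \<Longrightarrow> - X w \<in> W" "\<And>w. w \<in> W \<Longrightarrow> Y w \<in> W" "\<And>w. w \<in> W \<Longrightarrow> - Z w \<in> W"
    for W
  proof (rule irreducible[OF W(1) _ W(3)])
    show "X w \<in> W" "Z w \<in> W" if "w \<in> W" for w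
      using subspace_neg[OF W(1) W(2)[OF that]] subspace_neg[OF W(1) W(4)[OF that]] by simp_all
  qed
  show "- X (Y v) + Y (- X v) = 2 *s - Z v" for v
    using XY[of v] by (simp add: Y.neg algebra_simps)
  show "Y (- Z v) + - Z (Y v) = 2 *s - X v" for v
    using YZ[of v] by (simp add: Y.neg algebra_simps)
  show "- Z (- X v) + - X (- Z v) = 2 *s Y v" for v
    using ZX[of v] by (simp add: X.neg Z.neg)
qed (simp_all add: X.add Y.add Z.add X.scale Y.scale Z.scale finite_dimensional nontrivial)

lemma swapped: "anticommutator_triple scale Y X Z"
proof
  show "W = {0} \<or> W = UNIV"
    if "subspace W" "\<And>w. w \<in> W \<Longrightarrow> Y w \<in> W" "\<And>w. w \<in> W \<Longrightarrow> X w \<in> W" "\<And>w. w \<in> W \<Longrightarrow> Z w \<in> W" for W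
    by (rule irreducible[OF that(1,3,2,4)])
  show "Y (X v) + X (Y v) = 2 *s Z v" for v
    using XY[of v] by (simp add: add.commute)
  show "X (Z v) + Z (X v) = 2 *s Y v" for v
    using ZX[of v] by (simp add: add.commute)
  show "Z (Y v) + Y (Z v) = 2 *s X v" for v
    using YZ[of v] by (simp add: add.commute)
qed (simp_all add: X.add Y.add Z.add X.scale Y.scale Z.scale finite_dimensional nontrivial)

text \<open>The sign change turns \<open>L\<close> into the \<open>R\<close> of the flipped triple
  and negates the eigenvalues of \<open>X\<close>, while \<open>Y\<close> and the Casimir operator
  stay the same.\<close>

lemma standard_basis_chain_flipped:
  assumes "X w = - \<theta> *s w" "L w = \<mu> *s w" "w \<noteq> 0"
    and "\<theta> = 1 \<or> \<not> eigenvalue 1 \<and> \<not> eigenvalue (- 1)"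
  obtains d v t where "standard_basis d v t"
proof -
  interpret F: anticommutator_triple scale "\<lambda>v. - X v" Y "\<lambda>v. - Z v" by (rule flipped)
  have X: "- X v = c *s v \<longleftrightarrow> X v = - c *s v" for v c
    by (metis minus_minus scale_minus_left)
  have eig: "F.eigenvalue c \<longleftrightarrow> eigenvalue (- c)" for c
    by (simp add: F.eigenvalue_def eigenvalue_def X)
  have cas: "F.casimir v = casimir v" for v
    by (simp add: F.casimir_def casimir_def X.neg Z.neg)
  have "F.R w = \<mu> *s w"
    using assms(2) by (simp add: F.R_def L_def)
  with assms obtain d where "F.standard_basis d (F.chain w) (F.ev \<theta>)"
    by (elim F.standard_basis_chain[rotated]) (auto simp: eig X)
  then have "standard_basis d (F.chain w) (\<lambda>i. - F.ev \<theta> i)"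
    by (simp add: F.standard_basis_def standard_basis_def cas X inj_on_def)
  then show thesis by (rule that)
qed

text \<open>\<open>1\<close> is the fixed point of \<open>c \<mapsto> 2 - c\<close>, so
  \<open>R\<close> preserves this eigenspace of \<open>X\<close> and has an eigenvector in
  it.\<close>

lemma eigenvector_1:
  assumes "eigenvalue 1"
  obtains w \<mu> where "w \<noteq> 0" "X w = w" "R w = \<mu> *s w"
proof -
  let ?W = "{u. X u = u}"
  have "subspace ?W"
    by (simp add: subspace_def X.zero X.add X.scale)
  moreover have "R u \<in> ?W" if "u \<in> ?W" for u
    using that X_R[of u] by (simp add: scale_2)
  moreover obtain u where "u \<in> ?W" "u \<noteq> 0"
    using assms by (auto simp: eigenvalue_def)
  ultimately obtain \<mu> w where "w \<in> ?W" "w \<noteq> 0" "R w = \<mu> *s w"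
    by (rule eigenvector_exists[OF linear_R finite_dimensional])
  then show thesis using that by simp
qed

lemma standard_basis_exists:
  obtains d v t where "standard_basis d v t"
proof (cases "eigenvalue 1")
  case True
  then obtain w \<mu> where "w \<noteq> 0" "X w = w" "R w = \<mu> *s w"
    by (rule eigenvector_1)
  then show thesis
    using standard_basis_chain[of w 1 \<mu>] that by (metis scale_one)
next
  case no_pos: False
  interpret F: anticommutator_triple scale "\<lambda>v. - X v" Y "\<lambda>v. - Z v" by (rule flipped)
  have X: "- X v = v \<longleftrightarrow> X v = - v" for v
    by (metis minus_minus)
  show thesis
  proof (cases "eigenvalue (- 1)")
    case True
    then have "F.eigenvalue 1"
      by (simp add: F.eigenvalue_def eigenvalue_def X)
    then obtain w \<mu> where "w \<noteq> 0" "- X w = w" "F.R w = \<mu> *s w"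
      by (rule F.eigenvector_1)
    then have "X w = - 1 *s w" "L w = \<mu> *s w" "w \<noteq> 0"
      by (simp_all add: X F.R_def L_def)
    from standard_basis_chain_flipped[OF this] that show thesis
      by blast
  next
    case False
    note none = no_pos False
    obtain v :: 'v where "v \<noteq> 0" using nontrivial by auto
    then obtain \<theta> w where w: "w \<noteq> 0" "X w = \<theta> *s w"
      by (rule eigenvector_exists[OF linear_X finite_dimensional, of UNIV v, rotated 3])
        (auto simp: subspace_UNIV)
    \<comment> \<open>The last nonzero vector of a chain from an arbitrary eigenvector is killed by
      \<open>L\<close> or \<open>R\<close>, depending on the parity of \<open>d\<close>. It starts a
      new chain with \<open>\<mu> = 0\<close>, for the flipped triple in the case of
      \<open>L\<close>.\<close>
    obtain d where d: "chain w d \<noteq> 0" "chain w (Suc d) = 0"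
      using chain_terminates[OF w(2) _ w(1)] none by blast
    show thesis
    proof (cases "even d")
      case True
      then have "L (chain w d) = 0 *s chain w d"
        using d(2) by (simp add: step_def)
      moreover have "X (chain w d) = - (- ev \<theta> d) *s chain w d"
        using chain_eigenvector[OF w(2), of d] by simp
      ultimately show thesis
        using standard_basis_chain_flipped[of "chain w d" "- ev \<theta> d" 0] none d(1) that by blast
    next
      case False
      then have "R (chain w d) = 0 *s chain w d"
        using d(2) by (simp add: step_def)
      then show thesis
        using standard_basis_chain[of "chain w d" "ev \<theta> d" 0] none d(1) that
          chain_eigenvector[OF w(2), of d] by blast
    qed
  qed
qed

section \<open>Matrix entries in an arbitrary basis\<close>

text \<open>Eliminate \<open>Z\<close> by inserting \<open>2 Z = X Y + Y X\<close> into twice the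
  relation \<open>2 Y = Z X + X Z\<close>.\<close>

lemma cubic_relation: "X (X (Y v)) + 2 *s X (Y (X v)) + Y (X (X v)) = 4 *s Y v"
proof -
  have "4 *s Y v = 2 *s (Z (X v) + X (Z v))"
    by (simp add: ZX)
  also have "\<dots> = 2 *s Z (X v) + X (2 *s Z v)"
    by (simp add: scale_right_distrib X.scale)
  also have "\<dots> = (X (Y (X v)) + Y (X (X v))) + X (X (Y v) + Y (X v))"
    by (simp only: XY)
  finally show ?thesis
    by (simp add: X.add scale_2 algebra_simps)
qed

lemma diag_tridiag_standard:
  assumes "standard_basis d w t"
  shows "diag_tridiag_basis X Y d w"
proof -
  have w: "indexed_basis d w" "\<And>i. i \<le> d \<Longrightarrow> X (w i) = t i *s w i"
    using assms by (auto simp: standard_basis_def)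
  have "mat_of d w X i j = 0" if "i \<le> d" "j \<le> d" "i \<noteq> j" for i j
    using that by (simp add: mat_of_coord w(2) coord_scale[OF w(1)] coord_basis[OF w(1)])
  then show ?thesis
    using assms by (simp add: standard_basis_def diag_tridiag_basis_def diagonal_mat_def)
qed

lemma diag_tridiag_eigen:
  assumes "diag_tridiag_basis X Y d v" "i \<le> d"
  shows "X (v i) = mat_of d v X i i *s v i"
proof -
  have "X (v i) = (\<Sum>j\<le>d. mat_of d v X j i *s v j)"
    using assms by (simp add: diag_tridiag_basis_def mat_of_coord sum_coord)
  also have "\<dots> = (\<Sum>j\<le>d. if i = j then mat_of d v X i i *s v i else 0)"
    using assms by (intro sum.cong) (auto simp: diag_tridiag_basis_def diagonal_mat_def)
  finally show ?thesis
    using assms(2) by simp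
qed

text \<open>A standard basis has distinct eigenvalues. Two vectors of \<open>v\<close> with equal
  eigenvalue would be multiples of the same \<open>w k\<close>, hence proportional.\<close>

lemma diag_tridiag_simple_spectrum:
  assumes "diag_tridiag_basis X Y d v"
  shows "inj_on (\<lambda>i. mat_of d v X i i) {..d}"
proof (rule inj_onI)
  fix i j
  assume *: "i \<in> {..d}" "j \<in> {..d}" "mat_of d v X i i = mat_of d v X j j"
  have basis: "indexed_basis d v"
    using assms by (simp add: diag_tridiag_basis_def)
  obtain d' w t where "standard_basis d' w t" by (rule standard_basis_exists)
  then have w: "indexed_basis d' w" "\<And>i. i \<le> d' \<Longrightarrow> X (w i) = t i *s w i" "inj_on t {..d'}"
    by (auto simp: standard_basis_def)
  have vi: "X (v i) = mat_of d v X i i *s v i" and vj: "X (v j) = mat_of d v X i i *s v j"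
    using diag_tridiag_eigen[OF assms] * by auto
  obtain k where k: "k \<le> d'" "mat_of d v X i i = t k" "coord d' w k (v i) \<noteq> 0"
    using simple_spectrum_eigenvector[OF w(1) linear_X w(2) vi] indexed_basis_nonzero[OF basis] *
    by (metis atMost_iff)
  let ?a = "coord d' w k (v i)" and ?b = "coord d' w k (v j)"
  have "v i = ?a *s w k" "v j = ?b *s w k"
    using simple_spectrum_eigenspace[OF w(1) linear_X w(2,3) k(1)] vi vj k(2) by simp_all
  then have "v j = (?b / ?a) *s v i"
    using k(3) by (metis nonzero_eq_divide_eq scale_scale)
  then have "coord d v j (v j) = (?b / ?a) * coord d v j (v i)"
    by (metis coord_scale[OF basis])
  then show "i = j"
    using * by (auto simp: coord_basis[OF basis] split: if_splits)
qed

text \<open>In the \<open>(i, j)\<close> entry of \<open>cubic_relation\<close>, each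
  \<open>X\<close> to the left of \<open>Y\<close> contributes the eigenvalue at \<open>i\<close>
  and each \<open>X\<close> to the right the eigenvalue at \<open>j\<close>.\<close>

lemma diag_tridiag_entry:
  assumes "diag_tridiag_basis X Y d v" "i \<le> d" "j \<le> d" "mat_of d v Y i j \<noteq> 0"
  shows "(mat_of d v X i i + mat_of d v X j j)\<^sup>2 = 4"
proof -
  let ?\<theta> = "\<lambda>i. mat_of d v X i i" and ?a = "coord d v i (Y (v j))"
  have basis: "indexed_basis d v"
    using assms by (simp add: diag_tridiag_basis_def)
  note eig = diag_tridiag_eigen[OF assms(1)]
  have cX: "coord d v i (X u) = ?\<theta> i * coord d v i u" for u
    using coord_eigen[OF basis linear_X, of ?\<theta> i u] eig assms(2) by blast
  have "coord d v i (X (X (Y (v j))) + 2 *s X (Y (X (v j))) + Y (X (X (v j)))) =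
      ((?\<theta> i + ?\<theta> j)\<^sup>2) * ?a"
    using assms(3)
    by (simp add: coord_add[OF basis] coord_scale[OF basis] cX eig X.scale Y.scale
        power2_eq_square algebra_simps)
  moreover have "coord d v i (4 *s Y (v j)) = 4 * ?a"
    by (rule coord_scale[OF basis])
  ultimately have "(?\<theta> i + ?\<theta> j)\<^sup>2 * ?a = 4 * ?a"
    by (simp only: cubic_relation)
  then show ?thesis
    using assms(4) by (simp add: mat_of_coord[of d v Y])
qed

lemma diag_tridiag_diagonal:
  assumes "diag_tridiag_basis X Y d v" "i \<le> d" "mat_of d v Y i i \<noteq> 0"
  shows "(mat_of d v X i i)\<^sup>2 = 1"
proof -
  have "4 * (mat_of d v X i i)\<^sup>2 = 4 * 1"
    using diag_tridiag_entry[OF assms(1,2,2,3)] by (simp add: power2_eq_square algebra_simps)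
  then show ?thesis
    unfolding mult_cancel_left by simp
qed

text \<open>Both sums square to \<open>4\<close> because superdiagonal entries are nonzero. If they
  were equal, the eigenvalues at \<open>i\<close> and \<open>i + 2\<close> would coincide.\<close>

lemma diag_tridiag_sums:
  assumes "diag_tridiag_basis X Y d v" "Suc (Suc i) \<le> d"
  defines "\<theta> \<equiv> \<lambda>i. mat_of d v X i i"
  shows "(\<theta> i + \<theta> (Suc i))\<^sup>2 = 4" "\<theta> (Suc i) + \<theta> (Suc (Suc i)) = - (\<theta> i + \<theta> (Suc i))"
proof -
  have irr: "mat_of d v Y k (Suc k) \<noteq> 0" if "k < d" for k
    using assms(1) that by (simp add: diag_tridiag_basis_def irreducible_tridiagonal_mat_def)
  have sq: "(\<theta> k + \<theta> (Suc k))\<^sup>2 = 4" if "k < d" for k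
    unfolding \<theta>_def using that by (intro diag_tridiag_entry[OF assms(1)] irr) auto
  then show "(\<theta> i + \<theta> (Suc i))\<^sup>2 = 4"
    using assms(2) by simp
  then have "(\<theta> (Suc i) + \<theta> (Suc (Suc i)))\<^sup>2 = (\<theta> i + \<theta> (Suc i))\<^sup>2"
    using sq[of "Suc i"] assms(2) by simp
  moreover have "\<theta> i \<noteq> \<theta> (Suc (Suc i))"
    using inj_onD[OF diag_tridiag_simple_spectrum[OF assms(1)], of i "Suc (Suc i)"] assms(2)
    by (auto simp: \<theta>_def)
  ultimately show "\<theta> (Suc i) + \<theta> (Suc (Suc i)) = - (\<theta> i + \<theta> (Suc i))"
    by (auto simp: power2_eq_iff add.commute)
qed

lemma diag_tridiag_bannai_ito:
  assumes "diag_tridiag_basis X Y d v" "2 \<le> i" "i + 1 \<le> d"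
  defines "\<theta> \<equiv> \<lambda>i. mat_of d v X i i"
  shows "(\<theta> (i - 2) - \<theta> (i + 1)) / (\<theta> (i - 1) - \<theta> i) = - 1"
proof -
  obtain k where k: "i = Suc (Suc k)"
    using assms(2) by (metis add_2_eq_Suc le_Suc_ex)
  have sums: "\<theta> (Suc k) + \<theta> (Suc (Suc k)) = - (\<theta> k + \<theta> (Suc k))"
    "\<theta> (Suc (Suc k)) + \<theta> (Suc (Suc (Suc k))) = - (\<theta> (Suc k) + \<theta> (Suc (Suc k)))"
    using diag_tridiag_sums(2)[OF assms(1)] assms(3) by (simp_all add: k \<theta>_def)
  \<comment> \<open>The first and third sums agree, so each outer eigenvalue is this common value
    minus its inner neighbour.\<close>
  have "\<theta> k = - (\<theta> (Suc k) + \<theta> (Suc (Suc k))) - \<theta> (Suc k)"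
    unfolding sums(1) by simp
  moreover have "\<theta> (Suc (Suc (Suc k))) = - (\<theta> (Suc k) + \<theta> (Suc (Suc k))) - \<theta> (Suc (Suc k))"
    using sums(2) by (metis add_diff_cancel_left')
  ultimately have "\<theta> k - \<theta> (Suc (Suc (Suc k))) = - (\<theta> (Suc k) - \<theta> (Suc (Suc k)))"
    by simp
  \<comment> \<open>Division by zero gives \<open>0\<close>, so the denominator has to be nonzero
    for the quotient to be \<open>- 1\<close>.\<close>
  moreover have "\<theta> (Suc k) \<noteq> \<theta> (Suc (Suc k))"
    using inj_onD[OF diag_tridiag_simple_spectrum[OF assms(1)], of "Suc k" "Suc (Suc k)"] assms(3)
    by (auto simp: \<theta>_def k)
  ultimately show ?thesis
    by (simp add: k divide_eq_eq)
qed

text \<open>This property separates type \<open>AB\<close> from type \<open>B\<close>.\<close>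

definition half_type :: bool where
  "half_type \<longleftrightarrow> (\<exists>c. c\<^sup>2 = 1 \<and> eigenvalue c)"

section \<open>Diagonal entries and the two alternatives\<close>

text \<open>An eigenvalue with square \<open>1\<close> must occur among the \<open>t i\<close>,
  which rules out the second alternative of \<open>standard_basis\<close>.\<close>

lemma standard_basis_half_type:
  assumes "standard_basis d w t" "half_type"
  shows "(t 0)\<^sup>2 = 1" "\<And>i. i \<le> d \<Longrightarrow> (t i)\<^sup>2 = 1 \<Longrightarrow> i = 0" "mat_of d w Y 0 0 \<noteq> 0"
    "casimir u = (4 * (of_nat (Suc d))\<^sup>2 - 1) *s u"
proof -
  obtain c v where c: "c\<^sup>2 = 1" "X v = c *s v" "v \<noteq> 0"
    using assms(2) by (auto simp: half_type_def eigenvalue_def)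
  have w: "indexed_basis d w" "\<And>i. i \<le> d \<Longrightarrow> X (w i) = t i *s w i"
    using assms(1) by (auto simp: standard_basis_def)
  obtain k where "k \<le> d" "c = t k"
    using simple_spectrum_eigenvector[OF w(1) linear_X w(2) c(2,3)] by blast
  then have "\<not> (\<forall>i\<le>d. (t i)\<^sup>2 \<noteq> 1)"
    using c(1) by blast
  then show "(t 0)\<^sup>2 = 1" "\<And>i. i \<le> d \<Longrightarrow> (t i)\<^sup>2 = 1 \<Longrightarrow> i = 0" "mat_of d w Y 0 0 \<noteq> 0"
    "casimir u = (4 * (of_nat (Suc d))\<^sup>2 - 1) *s u"
    using assms(1) unfolding standard_basis_def by blast+
qed

lemma standard_basis_not_half_type:
  assumes "standard_basis d w t" "\<not> half_type"
  shows "casimir u = ((of_nat (Suc d))\<^sup>2 - 1) *s u"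
proof -
  have w: "indexed_basis d w" "X (w 0) = t 0 *s w 0"
    using assms(1) by (auto simp: standard_basis_def)
  have "(t 0)\<^sup>2 \<noteq> 1"
    using assms(2) w(2) indexed_basis_nonzero[OF w(1)] by (auto simp: half_type_def eigenvalue_def)
  then show ?thesis
    using assms(1) unfolding standard_basis_def by blast
qed

lemma half_type_swapped: "anticommutator_triple.half_type scale Y \<longleftrightarrow> half_type"
proof -
  interpret S: anticommutator_triple scale Y X Z by (rule swapped)
  obtain d w t where w: "standard_basis d w t" by (rule standard_basis_exists)
  obtain d' w' t' where w': "S.standard_basis d' w' t'" by (rule S.standard_basis_exists)
  have "dim UNIV = Suc d" "dim UNIV = Suc d'"
    using w w' indexed_basis_dim unfolding standard_basis_def S.standard_basis_def by blast+
  then have d: "d' = d" by simp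
  have cas: "S.casimir v = casimir v" for v
    by (simp add: S.casimir_def casimir_def add.commute)
  obtain u :: 'v where u: "u \<noteq> 0" using nontrivial by auto
  let ?n = "of_nat (Suc d) :: 'k"
  \<comment> \<open>The two possible Casimir scalars differ by \<open>3 n^2\<close>, nonzero in
    characteristic zero. Hence the scalar and the common dimension decide the alternative for
    \<open>X\<close> and \<open>Y\<close> alike.\<close>
  have "\<not> (4 * ?n\<^sup>2 - 1) *s u = (?n\<^sup>2 - 1) *s u"
  proof
    assume "(4 * ?n\<^sup>2 - 1) *s u = (?n\<^sup>2 - 1) *s u"
    then have "4 * ?n\<^sup>2 - 1 = ?n\<^sup>2 - 1"
      using u by simp
    then have "3 * ?n\<^sup>2 = 0" by (simp del: of_nat_Suc)
    then show False by (simp del: of_nat_Suc)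
  qed
  then show ?thesis
    using standard_basis_half_type(4)[OF w, of u] standard_basis_not_half_type[OF w, of u]
      S.standard_basis_half_type(4)[OF w', of u] S.standard_basis_not_half_type[OF w', of u]
    unfolding cas d by metis
qed

lemma diag_tridiag_bipartite:
  assumes "diag_tridiag_basis X Y d v" "\<not> half_type"
  shows "bipartite_mat d (mat_of d v Y)"
  unfolding bipartite_mat_def
proof (intro allI impI, rule ccontr)
  fix i assume i: "i \<le> d" "mat_of d v Y i i \<noteq> 0"
  have "v i \<noteq> 0"
    using assms(1) i(1) by (auto simp: diag_tridiag_basis_def indexed_basis_nonzero)
  then have "half_type"
    using diag_tridiag_diagonal[OF assms(1) i] diag_tridiag_eigen[OF assms(1) i(1)]
    unfolding half_type_def eigenvalue_def by blast
  with assms(2) show False ..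
qed

text \<open>Only \<open>t 0\<close> among the eigenvalues of \<open>X\<close> has square
  \<open>1\<close>, and it occurs in \<open>v\<close> at one index \<open>k\<close>. The other
  diagonal entries vanish, the one at \<open>k\<close> equals that of the standard basis, and
  \<open>k\<close> is an end of the basis.\<close>

lemma diag_tridiag_almost_bipartite:
  assumes v: "diag_tridiag_basis X Y d v" and "half_type"
  shows "almost_bipartite_mat d (mat_of d v Y)"
proof -
  let ?\<theta> = "\<lambda>i. mat_of d v X i i"
  obtain d' w t where st: "standard_basis d' w t" by (rule standard_basis_exists)
  then have w: "indexed_basis d' w" "\<And>i. i \<le> d' \<Longrightarrow> X (w i) = t i *s w i" "inj_on t {..d'}"
    by (auto simp: standard_basis_def)
  note half = standard_basis_half_type[OF st \<open>half_type\<close>]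
  have basis: "indexed_basis d v"
    using v by (simp add: diag_tridiag_basis_def)
  note eig = diag_tridiag_eigen[OF v]
  note inj = diag_tridiag_simple_spectrum[OF v]
  have t0: "?\<theta> i = t 0" if i: "i \<le> d" "(?\<theta> i)\<^sup>2 = 1" for i
  proof -
    obtain j where "j \<le> d'" "?\<theta> i = t j"
      using simple_spectrum_eigenvector[OF w(1) linear_X w(2) eig[OF i(1)]]
        indexed_basis_nonzero[OF basis i(1)] by blast
    then show ?thesis using half(2) i(2) by metis
  qed
  obtain k where k: "k \<le> d" "?\<theta> k = t 0"
    using simple_spectrum_eigenvector[OF basis linear_X eig w(2)[OF le0]]
      indexed_basis_nonzero[OF w(1), of 0] by (metis zero_le)
  have others: "mat_of d v Y i i = 0" if "i \<le> d" "i \<noteq> k" for i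
    using diag_tridiag_diagonal[OF v that(1)] t0[OF that(1)] k inj_onD[OF inj, of i k] that by force

  have "mat_of d v Y k k \<noteq> 0"
  proof -
    have cX: "coord d v k (X u) = t 0 * coord d v k u" for u
      using coord_eigen[OF basis linear_X, of ?\<theta> k u] eig k by metis
    \<comment> \<open>The functional \<open>coord d v k\<close> kills the eigenspaces of
      \<open>X\<close> other than that of \<open>t 0\<close>. As \<open>v k\<close> is a multiple of
      \<open>w 0\<close>, the diagonal entry can be computed in the basis \<open>w\<close>.\<close>
    have zero: "coord d v k (w j) = 0" if "j \<le> d'" "j \<noteq> 0" for j
    proof -
      have "t j * coord d v k (w j) = t 0 * coord d v k (w j)"
        using cX[of "w j"] w(2)[OF that(1)] by (simp add: coord_scale[OF basis])
      moreover have "t j \<noteq> t 0"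
        using w(3) that by (auto simp: inj_on_def)
      ultimately show ?thesis by simp
    qed
    define a where "a = coord d' w 0 (v k)"
    have vk: "v k = a *s w 0"
      unfolding a_def
      using simple_spectrum_eigenspace[OF w(1) linear_X w(2,3), of 0 "v k"] eig[OF k(1)] k(2)
      by simp
    have "Y (w 0) = (\<Sum>j\<le>d'. mat_of d' w Y j 0 *s w j)"
      by (simp add: mat_of_coord sum_coord[OF w(1)])
    also have "coord d v k \<dots> = (\<Sum>j\<le>d'. mat_of d' w Y j 0 * coord d v k (w j))"
    proof -
      have "coord d v k (\<Sum>j\<in>J. f j) = (\<Sum>j\<in>J. coord d v k (f j))" for J and f :: "nat \<Rightarrow> 'v"
        by (induction J rule: infinite_finite_induct)
          (auto simp: coord_zero[OF basis] coord_add[OF basis])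
      then show ?thesis by (simp add: coord_scale[OF basis])
    qed
    also have "\<dots> = (\<Sum>j\<le>d'. if 0 = j then mat_of d' w Y 0 0 * coord d v k (w 0) else 0)"
      by (intro sum.cong) (auto simp: zero)
    finally have Yw: "coord d v k (Y (w 0)) = mat_of d' w Y 0 0 * coord d v k (w 0)"
      by simp
    have "a * coord d v k (w 0) = 1"
      using coord_basis[OF basis k(1) k(1)] vk coord_scale[OF basis] by metis
    then have "mat_of d v Y k k = mat_of d' w Y 0 0"
      by (simp add: mat_of_coord[of d v] vk Y.scale coord_scale[OF basis] Yw mult.left_commute)
    then show ?thesis using half(3) by simp
  qed

  moreover have "k = 0 \<or> k = d"
  proof (rule ccontr)
    assume "\<not> ?thesis"
    then obtain i where i: "k = Suc i" "Suc (Suc i) \<le> d"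
      using k(1) by (cases k) auto
    have sums: "(?\<theta> i + t 0)\<^sup>2 = 4" "t 0 + ?\<theta> (Suc (Suc i)) = - (?\<theta> i + t 0)"
      using diag_tridiag_sums[OF v i(2)] k(2) unfolding i(1) by simp_all
    from sums(2) have *: "?\<theta> (Suc (Suc i)) = - (?\<theta> i + t 0) - t 0"
      by (metis add_diff_cancel_left')
    \<comment> \<open>At an inner \<open>k\<close>, with \<open>s = ?\<theta> i + t 0\<close>, the
      factors are \<open>s - 2 * t 0\<close> and \<open>- s - 2 * t 0\<close>. Their product
      vanishes since \<open>s^2 = 4\<close> and \<open>(t 0)^2 = 1\<close>, so a neighbour repeats
      the eigenvalue at \<open>k\<close>.\<close>
    have "(?\<theta> i - t 0) * (?\<theta> (Suc (Suc i)) - t 0) = 4 * (t 0)\<^sup>2 - (?\<theta> i + t 0)\<^sup>2"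
      unfolding * by (simp add: power2_eq_square algebra_simps)
    then have "(?\<theta> i - t 0) * (?\<theta> (Suc (Suc i)) - t 0) = 0"
      unfolding sums(1) half(1) by simp
    then have "?\<theta> i = ?\<theta> k \<or> ?\<theta> (Suc (Suc i)) = ?\<theta> k"
      by (simp add: k(2))
    then show False
      using inj_onD[OF inj, of i k] inj_onD[OF inj, of "Suc (Suc i)" k] i by auto
  qed
  ultimately show ?thesis
    using others k(1) unfolding almost_bipartite_mat_def by auto
qed

section \<open>The scaled pair\<close>

lemma scaled_leonard_pair:
  assumes "a \<noteq> 0" "b \<noteq> 0"
  shows "leonard_pair (\<lambda>u. a *s X u) (\<lambda>u. b *s Y u)"
proof -
  interpret S: anticommutator_triple scale Y X Z by (rule swapped)
  obtain d w t where w: "standard_basis d w t" by (rule standard_basis_exists)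
  obtain d' w' t' where w': "S.standard_basis d' w' t'" by (rule S.standard_basis_exists)
  have "dim UNIV = Suc d" "dim UNIV = Suc d'"
    using w w' indexed_basis_dim unfolding standard_basis_def S.standard_basis_def by blast+
  \<comment> \<open>A Leonard pair requires one \<open>d\<close> for both bases; the dimension
    supplies it.\<close>
  then have "d' = d" by simp
  then have "diag_tridiag_basis (\<lambda>u. a *s X u) (\<lambda>u. b *s Y u) d w"
    "diag_tridiag_basis (\<lambda>u. b *s Y u) (\<lambda>u. a *s X u) d w'"
    using diag_tridiag_standard[OF w] S.diag_tridiag_standard[OF w'] assms
    by (simp_all add: diag_tridiag_basis_scale)
  then show ?thesis
    unfolding leonard_pair_def using linear_scaled[OF linear_X] linear_scaled[OF linear_Y] by blast
qed

lemma scaled_bannai_ito_type: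
  assumes "a \<noteq> 0" "b \<noteq> 0"
  shows "bannai_ito_type (\<lambda>u. a *s X u) (\<lambda>u. b *s Y u)"
proof -
  interpret S: anticommutator_triple scale Y X Z by (rule swapped)
  have ratio: "(mat_of d v (\<lambda>u. c *s T u) p p - mat_of d v (\<lambda>u. c *s T u) q q) /
        (mat_of d v (\<lambda>u. c *s T u) r r - mat_of d v (\<lambda>u. c *s T u) s s) =
      (mat_of d v T p p - mat_of d v T q q) / (mat_of d v T r r - mat_of d v T s s)"
    if "indexed_basis d v" "c \<noteq> 0" for d v c T p q r s
    using that by (simp add: mat_of_scale flip: right_diff_distrib)
  have "indexed_basis d v" if "diag_tridiag_basis T T' d v" for T T' d v
    using that by (simp add: diag_tridiag_basis_def)
  then show ?thesis
    unfolding bannai_ito_type_def Let_def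
    using scaled_leonard_pair[OF assms] diag_tridiag_bannai_ito S.diag_tridiag_bannai_ito assms
    by (auto simp: diag_tridiag_basis_scale ratio)
qed

lemma scaled_totally_bipartite:
  assumes "a \<noteq> 0" "b \<noteq> 0" "\<not> half_type"
  shows "totally_bipartite (\<lambda>u. a *s X u) (\<lambda>u. b *s Y u)"
proof -
  interpret S: anticommutator_triple scale Y X Z by (rule swapped)
  have "indexed_basis d v" if "diag_tridiag_basis T T' d v" for T T' d v
    using that by (simp add: diag_tridiag_basis_def)
  then show ?thesis
    unfolding totally_bipartite_def
    using scaled_leonard_pair[OF assms(1,2)] diag_tridiag_bipartite S.diag_tridiag_bipartite assms
      half_type_swapped
    by (auto simp: diag_tridiag_basis_scale bipartite_mat_scale)
qed

lemma scaled_totally_almost_bipartite: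
  assumes "a \<noteq> 0" "b \<noteq> 0" "half_type"
  shows "totally_almost_bipartite (\<lambda>u. a *s X u) (\<lambda>u. b *s Y u)"
proof -
  interpret S: anticommutator_triple scale Y X Z by (rule swapped)
  have "indexed_basis d v" if "diag_tridiag_basis T T' d v" for T T' d v
    using that by (simp add: diag_tridiag_basis_def)
  then show ?thesis
    unfolding totally_almost_bipartite_def
    using scaled_leonard_pair[OF assms(1,2)] diag_tridiag_almost_bipartite
      S.diag_tridiag_almost_bipartite assms half_type_swapped
    by (auto simp: diag_tridiag_basis_scale bipartite_mat_scale)
qed

end

section \<open>Modules\<close>

text \<open>Words are products of generators, monomials are scalar multiples of words, and elements
  are finite sums of monomials.\<close>

lemma free_alg_induct [case_names gen one add mult scale]:
  fixes p :: "'k::field free_alg"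
  assumes gen: "\<And>g. P (free_gen g)" and one: "P 1"
    and add: "\<And>p q. P p \<Longrightarrow> P q \<Longrightarrow> P (p + q)" and mult: "\<And>p q. P p \<Longrightarrow> P q \<Longrightarrow> P (p * q)"
    and scale: "\<And>c p. P p \<Longrightarrow> P (free_scale c p)"
  shows "P p"
proof -
  have word: "P (Poly_Mapping.single (Word l) 1)" for l
  proof (induction l)
    case Nil
    then show ?case using one by (simp add: zero_gword_def[symmetric])
  next
    case (Cons g l)
    have "Poly_Mapping.single (Word (g # l)) 1 =
        (free_gen g * Poly_Mapping.single (Word l) 1 :: 'k free_alg)"
      by (simp add: free_gen_def mult_single)
    then show ?case using mult[OF gen Cons] by simp
  qed
  have single: "P (Poly_Mapping.single x c)" for x c
  proof -
    obtain l where "x = Word l" by (cases x)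
    then have "Poly_Mapping.single x c = free_scale c (Poly_Mapping.single (Word l) 1)"
      by (simp add: free_scale_def mult_single)
    then show ?thesis using scale[OF word] by simp
  qed
  show ?thesis
  proof (induction p rule: update_induct)
    case const
    show ?case using single[of 0 0] by simp
  next
    case (update f a b)
    \<comment> \<open>The key \<open>a\<close> is new to \<open>f\<close>, so updating there amounts
      to adding a monomial.\<close>
    have "Poly_Mapping.update a b f = f + Poly_Mapping.single a b"
      using update(1) by (intro poly_mapping_eqI)
        (auto simp: lookup_update lookup_add lookup_single in_keys_iff when_def)
    then show ?case using add[OF update(3) single] by simp
  qed
qed

lemma bi_alg_induct [case_names gen one add mult scale]:
  fixes a :: "'k::field bi_alg"
  assumes "\<And>g. P (alg_gen g)" "P 1"
    "\<And>p q. P p \<Longrightarrow> P q \<Longrightarrow> P (p + q)" "\<And>p q. P p \<Longrightarrow> P q \<Longrightarrow> P (p * q)"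
    "\<And>c p. P p \<Longrightarrow> P (alg_scale c p)"
  shows "P a"
proof -
  obtain p where "a = abs_bi_alg p"
    by (metis Quotient_abs_rep[OF Quotient_bi_alg])
  moreover have "P (abs_bi_alg p)"
  proof (induction p rule: free_alg_induct)
    case (gen g)
    then show ?case using assms(1)[of g] by (simp add: alg_gen_def)
  next
    case one
    then show ?case using assms(2) by (simp add: one_bi_alg_def)
  next
    case (add p q)
    then show ?case using assms(3)[OF add] by (simp add: plus_bi_alg.abs_eq)
  next
    case (mult p q)
    then show ?case using assms(4)[OF mult] by (simp add: times_bi_alg.abs_eq)
  next
    case (scale c p)
    then show ?case using assms(5)[OF scale, of c] by (simp add: alg_scale.abs_eq)
  qed
  ultimately show ?thesis by simp
qed

context bi_module
begin

text \<open>Stability under the generators extends to the whole algebra by induction, which links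
  irreducibility of the module to that of the three operators.\<close>

lemma submoduleI:
  assumes "subspace W" "\<And>g w. w \<in> W \<Longrightarrow> act (alg_gen g) w \<in> W"
  shows "submodule W"
proof -
  have "\<forall>w\<in>W. act a w \<in> W" for a
    by (induction a rule: bi_alg_induct)
      (auto simp: act_one act_add_left act_mult act_scale_left assms
        intro: subspace_add[OF assms(1)] subspace_scale[OF assms(1)])
  with assms(1) show ?thesis
    by (simp add: submodule_def)
qed

end

lemma anticommutator_triple_act:
  fixes scale :: "'k::{alg_closed_field, field_char_0} \<Rightarrow> 'v::ab_group_add \<Rightarrow> 'v"
  assumes "bi_module scale act" "vector_space.fin_dim scale" "bi_module.irreducible_module scale act"
  shows "anticommutator_triple scale (act (alg_gen X)) (act (alg_gen Y)) (act (alg_gen Z))"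
proof -
  interpret bi_module scale act by fact
  have two: "act (2 * a) v = scale 2 (act a v)" for a v
    by (metis act_add_left mult_2 one_add_one scale_left_distrib scale_one)
  show ?thesis
  proof
    show "act (alg_gen X) (act (alg_gen Y) v) + act (alg_gen Y) (act (alg_gen X) v) =
        scale 2 (act (alg_gen Z) v)"
      "act (alg_gen Y) (act (alg_gen Z) v) + act (alg_gen Z) (act (alg_gen Y) v) =
        scale 2 (act (alg_gen X) v)"
      "act (alg_gen Z) (act (alg_gen X) v) + act (alg_gen X) (act (alg_gen Z) v) =
        scale 2 (act (alg_gen Y) v)" for v
      by (simp_all add: bi_alg_relations flip: act_mult act_add_left two)
    show "W = {0} \<or> W = UNIV"
      if W: "subspace W" "\<And>w. w \<in> W \<Longrightarrow> act (alg_gen X) w \<in> W"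
        "\<And>w. w \<in> W \<Longrightarrow> act (alg_gen Y) w \<in> W" "\<And>w. w \<in> W \<Longrightarrow> act (alg_gen Z) w \<in> W" for W
    proof -
      have "act (alg_gen g) w \<in> W" if "w \<in> W" for g w
        using W that by (cases g) auto
      with W(1) assms(3) show ?thesis
        using submoduleI unfolding irreducible_module_def by blast
    qed
  qed (use assms in \<open>auto simp: act_add_right act_scale_right irreducible_module_def\<close>)
qed

theorem theorem8p15:
  fixes scale :: "'k::{alg_closed_field, field_char_0} \<Rightarrow> 'v::ab_group_add \<Rightarrow> 'v"
    and act :: "'k bi_alg \<Rightarrow> 'v \<Rightarrow> 'v"
    and \<xi> \<xi>' :: 'k
  assumes "bi_module scale act"
    and "vector_space.fin_dim scale"
    and "bi_module.irreducible_module scale act"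
    and "\<xi> \<noteq> 0" and "\<xi>' \<noteq> 0"
  defines "A \<equiv> act (alg_scale \<xi> (alg_gen X))"
    and "A' \<equiv> act (alg_scale \<xi>' (alg_gen Y))"
  shows "vector_space.leonard_pair scale A A' \<and>
    vector_space.bannai_ito_type scale A A' \<and>
    (bi_module.type_B scale act \<longrightarrow> vector_space.totally_bipartite scale A A') \<and>
    (bi_module.type_AB scale act \<longrightarrow> vector_space.totally_almost_bipartite scale A A')"
proof -
  interpret bi_module scale act by fact
  let ?X = "act (alg_gen X)" and ?Y = "act (alg_gen Y)" and ?Z = "act (alg_gen Z)"
  interpret T: anticommutator_triple scale ?X ?Y ?Z
    by (rule anticommutator_triple_act[OF assms(1-3)])
  have A: "A = (\<lambda>u. scale \<xi> (?X u))" and A': "A' = (\<lambda>u. scale \<xi>' (?Y u))"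
    by (simp_all add: A_def A'_def act_scale_left fun_eq_iff)

  have "\<not> T.half_type" if "type_B"
  proof
    assume "T.half_type"
    then obtain c u where c: "c\<^sup>2 = 1" "?X u = scale c u" "u \<noteq> 0"
      by (auto simp: T.half_type_def T.eigenvalue_def)
    obtain d v where v: "even d" "indexed_basis d v"
      "\<And>i. i \<le> d \<Longrightarrow> ?X (v i) = scale ((- 1) ^ i * (of_nat d - 2 * of_nat i)) (v i)"
      using \<open>type_B\<close> unfolding type_B_def type_B_of_def Let_def by auto
    obtain i where "c = (- 1) ^ i * (of_nat d - 2 * of_nat i)"
      using simple_spectrum_eigenvector[OF v(2) T.linear_X v(3) c(2,3)] by blast
    moreover obtain e where "d = 2 * e" using v(1) by (elim evenE)
    \<comment> \<open>In type \<open>B\<close> the eigenvalues of \<open>x\<close> are even integers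
      up to sign. Passing through \<open>of_int\<close>, injective in characteristic zero, moves the
      parity argument to the integers.\<close>
    ultimately have "c = (- 1) ^ i * of_int (2 * (int e - int i))"
      by (simp add: algebra_simps)
    then have "c\<^sup>2 = of_int ((2 * (int e - int i))\<^sup>2)"
      by (cases "even i") (simp_all add: power2_commute)
    then have "of_int ((2 * (int e - int i))\<^sup>2) = (of_int 1 :: 'k)"
      using c(1) by simp
    then have "(2 * (int e - int i))\<^sup>2 = 1"
      by (simp only: of_int_eq_iff)
    then have "2 * (int e - int i) = 1 \<or> 2 * (int e - int i) = - 1"
      by (simp only: power2_eq_1_iff)
    then show False by presburger
  qed
  moreover have "T.half_type" if "type_AB"
  proof -
    obtain d n v where v: "indexed_basis d v" and
      "\<And>i. i \<le> d \<Longrightarrow>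
        ?X (v i) = scale (hat X n * (- 1) ^ (d + i) * (2 * of_nat d - 2 * of_nat i + 1)) (v i)"
      using \<open>type_AB\<close> unfolding type_AB_def type_AB_of_def Let_def by auto
    \<comment> \<open>At \<open>i = d\<close> the sign is \<open>(- 1) ^ (d + d) = 1\<close> and the
      last factor is \<open>1\<close>, which leaves the eigenvalue \<open>hat X n\<close>.\<close>
    then have "?X (v d) = scale (hat X n) (v d)"
      by (simp add: power_add flip: power_mult_distrib)
    moreover have "(hat X n)\<^sup>2 = 1"
      by (simp add: hat_def)
    ultimately show ?thesis
      using indexed_basis_nonzero[OF v, of d]
      unfolding T.half_type_def T.eigenvalue_def by blast
  qed
  ultimately show ?thesis
    using T.scaled_leonard_pair T.scaled_bannai_ito_type T.scaled_totally_bipartite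
      T.scaled_totally_almost_bipartite assms(4,5)
    unfolding A A' by blast
qed

end
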